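(* Let $d \ge 2$ be an integer, let $p_1, \ldots, p_d \in \mathbb{N}$, set $p = p_1 + \dots + p_d$, let $\alpha$ be a real number with $2\alpha \in \mathbb{N} \cup (p-1, \infty)$, and let $\Sigma$ be a real symmetric positive semidefinite matrix of size $p \times p$. Let $\boldsymbol{X} = (X_1, \ldots, X_d)$ be a random vector with the multivariate trace-Wishart distribution $\mathrm{TW}_{p_1,\dots,p_d}(\alpha, \Sigma)$. Then for any integer $d_1 \in \{1, \ldots, d-1\}$, the following statements hold. (a) For any reals $q_1, \ldots, q_d \in (-\alpha, 0]$, \[ \mathbb{E}\left( \prod_{i=1}^d X_i^{q_i} \right) \geq \mathbb{E}\left( \prod_{i=1}^{d_1} X_i^{q_i} \right) \mathbb{E}\left( \prod_{i=d_1+1}^d X_i^{q_i} \right). \] (b) For any reals $r_1, \ldots, r_d \in [0,1]$, \[ \mathbb{E}\left( \prod_{i=1}^d e^{-X_i^{r_i}} \right) \geq \mathbb{E}\left( \prod_{i=1}^{d_1} e^{-X_i^{r_i}} \right) \mathbb{E}\left( \prod_{i=d_1+1}^d e^{-X_i^{r_i}} \right). \] (c) For any integer $n \in \mathbb{N}$ and any sequence $A_1, \ldots, A_d$ of symmetric positive semidefinite matrices of size $n \times n$, \[ \mathrm{tr}\left[ \mathbb{E}\left\{ \exp\left( -\oplus_{i=1}^d X_i A_i \right) \right\} - \mathbb{E}\left\{ \exp\left( -\oplus_{i=1}^{d_1} X_i A_i \right) \right\} \otimes \mathbb{E}\left\{ \exp\left( -\oplus_{i=d_1+1}^d X_i A_i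 \right) \right\} \right] \geq 0, \] where $\otimes$ denotes the Kronecker product and $\oplus$ the Kronecker sum.
   Context: $\mathbb{N} = \{1, 2, \ldots\}$; $|\cdot|$ denotes the determinant and $\mathrm{I}_m$ the $m \times m$ identity matrix. Multivariate trace-Wishart distribution: for $d \ge 2$, $p_1, \ldots, p_d \in \mathbb{N}$, $p = p_1 + \dots + p_d$, $2\alpha \in \mathbb{N} \cup (p-1,\infty)$ and $\Sigma$ a $p \times p$ symmetric positive semidefinite matrix, a $d$-dimensional random vector $\boldsymbol{X}$ is said to follow $\mathrm{TW}_{p_1,\dots,p_d}(\alpha,\Sigma)$ if and only if, for all $\boldsymbol{t} = (t_1, \ldots, t_d) \in [0,\infty)^d$, \[ \mathbb{E}\big(e^{-\boldsymbol{t}^\top \boldsymbol{X}}\big) = \big| \mathrm{I}_p + \mathrm{diag}(t_1 \mathrm{I}_{p_1}, \dots, t_d \mathrm{I}_{p_d}) \, \Sigma \big|^{-\alpha}, \] where $\mathrm{diag}(\cdot)$ is the block-diagonal matrix. Equivalently, $\boldsymbol{X}$ has the same distribution as $(\mathrm{tr}(W_{11}), \ldots, \mathrm{tr}(W_{dd}))$, where $W \sim \mathrm{Wishart}_p(2\alpha, \Sigma/2)$ has diagonal blocks $W_{ii}$ of size $p_i \times p_i$; in particular its components are almost surely nonnegative. Kronecker sum: for square matrices $A$ ($m \times m$) and $B$ ($k \times k$), $A \oplus B = A \otimes \mathrm{I}_k + \mathrm{I}_m \otimes B$, iterated associatively for more than two terms (a single term being itself). $\exp$ of a matrix is the matrix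 exponential, $\mathrm{tr}$ is the trace, and expectations of random matrices are taken entrywise. Conventions: expectations of nonnegative random variables are taken in $[0,\infty]$; $0^0 = 1$ and $0^q = +\infty$ for $q < 0$ (relevant only in degenerate cases). *)

theory Defs
  imports
    "HOL-Probability.Probability"
    "Jordan_Normal_Form.Determinant"
begin

text \<open>
  Sizes such as \<open>p\<^sub>1 + \<dots> + p\<^sub>d\<close> and \<open>n ^ d\<close> are computed from natural number parameters, so matrices
  carry their dimensions as values. Several names (\<open>mat\<close>, \<open>det\<close>, \<open>trace\<close>, \<open>vec\<close>) also exist
  for the type-indexed matrices of HOL-Analysis; qualified names refer to the matrices used here.
\<close>

definition psd_mat :: "nat \<Rightarrow> real mat \<Rightarrow> bool" where
  "psd_mat n A \<longleftrightarrow> A \<in> carrier_mat n n \<and> transpose_mat A = A \<and>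
     (\<forall>v \<in> carrier_vec n. scalar_prod v (A *\<^sub>v v) \<ge> 0)"

definition mat_trace :: "real mat \<Rightarrow> real" where
  "mat_trace A = (\<Sum>i < dim_row A. A $$ (i, i))"

text \<open>The series below converges absolutely for every square matrix.\<close>

definition mat_exp :: "real mat \<Rightarrow> real mat" where
  "mat_exp A = Matrix.mat (dim_row A) (dim_row A) (\<lambda>(i, j). \<Sum>k. (A ^\<^sub>m k) $$ (i, j) / fact k)"

definition kron_prod :: "real mat \<Rightarrow> real mat \<Rightarrow> real mat" where
  "kron_prod A B = Matrix.mat (dim_row A * dim_row B) (dim_col A * dim_col B)
     (\<lambda>(i, j). A $$ (i div dim_row B, j div dim_col B) * B $$ (i mod dim_row B, j mod dim_col B))"

definition kron_sum :: "real mat \<Rightarrow> real mat \<Rightarrow> real mat" where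
  "kron_sum A B = kron_prod A (1\<^sub>m (dim_row B)) + kron_prod (1\<^sub>m (dim_row A)) B"

text \<open>The empty case is the neutral element of \<^const>\<open>kron_sum\<close>.\<close>

fun kron_sum_list :: "real mat list \<Rightarrow> real mat" where
  "kron_sum_list [] = 0\<^sub>m 1 1"
| "kron_sum_list [A] = A"
| "kron_sum_list (A # B # As) = kron_sum A (kron_sum_list (B # As))"

definition mat_expectation :: "'a measure \<Rightarrow> nat \<Rightarrow> ('a \<Rightarrow> real mat) \<Rightarrow> real mat" where
  "mat_expectation M n Y = Matrix.mat n n (\<lambda>(i, j). \<integral>\<omega>. Y \<omega> $$ (i, j) \<partial>M)"

text \<open>
  Powers of a nonnegative base with \<open>0\<^sup>0 = 1\<close>, and \<open>0\<^sup>q = \<infinity>\<close> for \<open>q < 0\<close> in the extended version;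
  in contrast, \<open>0 powr q = 0\<close> for all \<open>q\<close>. The values at negative bases are irrelevant: they
  are only attained on a null set.
\<close>

definition rpow :: "real \<Rightarrow> real \<Rightarrow> real" where
  "rpow x r = (if r = 0 then 1 else x powr r)"

definition epow :: "real \<Rightarrow> real \<Rightarrow> ennreal" where
  "epow x q = (if x = 0 \<and> q < 0 then \<infinity> else ennreal (rpow x q))"

text \<open>
  A random vector \<open>X\<close> is given by its components \<open>X 1, \<dots>, X d\<close>. The Laplace transform is taken
  in \<open>[0, \<infinity>]\<close>, so that no integrability or sign of \<open>X\<close> is presupposed; nonnegativity
  almost surely follows from the equation.
\<close>

definition trace_wishart ::
  "'a measure \<Rightarrow> nat \<Rightarrow> (nat \<Rightarrow> nat) \<Rightarrow> real \<Rightarrow> real mat \<Rightarrow> (nat \<Rightarrow> 'a \<Rightarrow> real) \<Rightarrow> bool" where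
  "trace_wishart M d p \<alpha> \<Sigma> X \<longleftrightarrow>
     (\<forall>i \<in> {1..d}. X i \<in> borel_measurable M) \<and>
     (\<forall>t :: nat \<Rightarrow> real. (\<forall>i \<in> {1..d}. t i \<ge> 0) \<longrightarrow>
        (\<integral>\<^sup>+ \<omega>. ennreal (exp (- (\<Sum>i = 1..d. t i * X i \<omega>))) \<partial>M) =
        ennreal (Determinant.det
          (1\<^sub>m (\<Sum>i = 1..d. p i) +
           diag_block_mat (map (\<lambda>i. t i \<cdot>\<^sub>m 1\<^sub>m (p i)) [1..<d + 1]) * \<Sigma>) powr (- \<alpha>)))"

end

theory Submission
  imports
    Defs
    "HOL-Real_Asymp.Real_Asymp"
    "Jordan_Normal_Form.Schur_Decomposition"
begin

text \<open>
  All three inequalities are obtained by mixing the single inequality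
  \<open>E exp (- t \<bullet> X) \<ge> E exp (- t\<^sub>I \<bullet> X\<^sub>I) E exp (- t\<^sub>J \<bullet> X\<^sub>J)\<close> between Laplace transforms. Since
  \<open>det (I + T \<Sigma>) = det (I + T\<^sup>1\<^sup>/\<^sup>2 \<Sigma> T\<^sup>1\<^sup>/\<^sup>2)\<close>, that inequality is Fischer's determinant inequality for a
  positive definite matrix, raised to the power \<open>- \<alpha>\<close>.

  A nonnegative combination, or a bounded pointwise limit, of functions \<open>x \<mapsto> exp (- t x)\<close>
  can replace each exponential, one coordinate at a time. The functions \<open>exp (- x\<^sup>r)\<close> and
  \<open>(x + \<epsilon>)\<^sup>q\<close> arise in this way without Bernstein's theorem: replace \<open>x\<close> by \<open>n (1 - exp (- x / n))\<close>
  and expand by the binomial series, whose coefficients have the right signs. Part (a) follows as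
  \<open>\<epsilon> \<rightarrow> 0\<close> by monotone convergence. For part (c), the exponential of a Kronecker sum is the
  Kronecker product of the exponentials, so its trace is a product of the functions
  \<open>tr exp (- x A) = (\<Sum>j. exp (- \<lambda>\<^sub>j x))\<close> with \<open>\<lambda>\<^sub>j \<ge> 0\<close>.
\<close>

subsection \<open>Mixtures of exponentials\<close>

text \<open>Membership is given by closure rules in place of a representing measure: each rule is an
  operation under which nonnegativity of
  \<open>\<integral>\<omega>. g (Z \<omega>) * H \<omega> \<partial>M\<close>, for a fixed bounded
  weight \<open>H\<close> of either sign, survives. The uniform bound \<open>B\<close> in
  \<open>limit\<close> is there for dominated convergence. Arguments enter through
  \<open>\<bar>x\<bar>\<close> because a trace-Wishart vector is nonnegative only almost surely,
  while boundedness on the whole line keeps every integral finite. Every member is bounded, so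
  \<open>x powr q\<close> with \<open>q < 0\<close> lies outside the class; the shift \<epsilon>
  repairs this, and it also keeps the exponentials uniformly below 1, inside the disc of convergence
  of the binomial series.\<close>

inductive abs_exp_mixture :: "(real \<Rightarrow> real) \<Rightarrow> bool" where
  exp: "t \<ge> 0 \<Longrightarrow> abs_exp_mixture (\<lambda>x. exp (- t * \<bar>x\<bar>))"
| add: "abs_exp_mixture f \<Longrightarrow> abs_exp_mixture g \<Longrightarrow> abs_exp_mixture (\<lambda>x. f x + g x)"
| scale: "c \<ge> 0 \<Longrightarrow> abs_exp_mixture f \<Longrightarrow> abs_exp_mixture (\<lambda>x. c * f x)"
| limit: "(\<And>n. abs_exp_mixture (F n)) \<Longrightarrow> (\<And>n x. F n x \<le> B) \<Longrightarrow> (\<And>x. (\<lambda>n. F n x) \<longlonglongrightarrow> f x)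
    \<Longrightarrow> abs_exp_mixture f"

lemma abs_exp_mixture_nonneg: "abs_exp_mixture f \<Longrightarrow> f x \<ge> 0"
proof (induction arbitrary: x rule: abs_exp_mixture.induct)
  case (limit F B f)
  then show ?case by (intro LIMSEQ_le_const[OF limit(3)]) auto
qed auto

lemma abs_exp_mixture_bounded: "abs_exp_mixture f \<Longrightarrow> \<exists>B\<ge>0. \<forall>x. f x \<le> B"
proof (induction rule: abs_exp_mixture.induct)
  case (exp t)
  then show ?case by (intro exI[of _ 1]) auto
next
  case (add f g)
  then obtain B C where "B \<ge> 0" "C \<ge> 0" "\<forall>x. f x \<le> B" "\<forall>x. g x \<le> C" by blast
  then show ?case by (intro exI[of _ "B + C"]) (auto intro: add_mono)
next
  case (scale c f)
  then obtain B where "B \<ge> 0" "\<forall>x. f x \<le> B" by blast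
  with scale show ?case by (intro exI[of _ "c * B"]) (auto intro: mult_left_mono)
next
  case (limit F B f)
  have "f x \<le> \<bar>B\<bar>" for x
    by (rule LIMSEQ_le_const2[OF limit(3)]) (meson abs_ge_self limit(2) order.trans)
  then show ?case by (intro exI[of _ "\<bar>B\<bar>"]) auto
qed

lemma abs_exp_mixture_measurable [measurable]:
  "abs_exp_mixture f \<Longrightarrow> f \<in> borel_measurable borel"
proof (induction rule: abs_exp_mixture.induct)
  case (limit F B f)
  show ?case by (rule borel_measurable_LIMSEQ_real[OF limit(3,4)])
qed auto

lemma abs_exp_mixture_const: "c \<ge> 0 \<Longrightarrow> abs_exp_mixture (\<lambda>x. c)"
  using abs_exp_mixture.scale[OF _ abs_exp_mixture.exp[of 0], of c] by simp

text \<open>Exponentials multiply by adding their rates, and a product is linear and continuous in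
  each factor. The outer induction runs over the rules for \<open>f\<close>; only its exponential
  case calls for the inner induction over the rules for \<open>g\<close>.\<close>

lemma abs_exp_mixture_mult:
  assumes "abs_exp_mixture f" "abs_exp_mixture g"
  shows "abs_exp_mixture (\<lambda>x. f x * g x)"
  using assms(1)
proof (induction rule: abs_exp_mixture.induct)
  case (exp t)
  note t = exp
  show ?case using assms(2)
  proof (induction rule: abs_exp_mixture.induct)
    case (exp s)
    show ?case using abs_exp_mixture.exp[of "t + s"] t exp
      by (simp add: algebra_simps flip: exp_add)
  next
    case (add f g)
    show ?case using abs_exp_mixture.add[OF add.IH] by (simp add: algebra_simps)
  next
    case (scale c f)
    show ?case using abs_exp_mixture.scale[OF scale(1) scale.IH] by (simp add: algebra_simps)
  next
    case (limit F B f)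
    show ?case
    proof (rule abs_exp_mixture.limit[where F = "\<lambda>n x. exp (- t * \<bar>x\<bar>) * F n x" and B = "\<bar>B\<bar>"])
      show "exp (- t * \<bar>x\<bar>) * F n x \<le> \<bar>B\<bar>" for n x
        using mult_mono[of "exp (- t * \<bar>x\<bar>)" 1 "F n x" "\<bar>B\<bar>"] t limit(2)[of n x]
          abs_exp_mixture_nonneg[OF limit(1)] by fastforce
      show "(\<lambda>n. exp (- t * \<bar>x\<bar>) * F n x) \<longlonglongrightarrow> exp (- t * \<bar>x\<bar>) * f x" for x
        by (intro tendsto_intros limit(3))
    qed (use limit in auto)
  qed
next
  case (add f1 f2)
  show ?case using abs_exp_mixture.add[OF add.IH] by (simp add: algebra_simps)
next
  case (scale c f)
  show ?case using abs_exp_mixture.scale[OF scale(1) scale.IH] by (simp add: algebra_simps)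
next
  case (limit F B f)
  obtain C where C: "C \<ge> 0" "\<And>x. g x \<le> C" using abs_exp_mixture_bounded[OF assms(2)] by blast
  show ?case
  proof (rule abs_exp_mixture.limit[where F = "\<lambda>n x. F n x * g x" and B = "\<bar>B\<bar> * C"])
    show "F n x * g x \<le> \<bar>B\<bar> * C" for n x
      using limit(2)[of n x] C abs_exp_mixture_nonneg[OF assms(2)]
      by (intro mult_mono) auto
    show "(\<lambda>n. F n x * g x) \<longlonglongrightarrow> f x * g x" for x
      by (intro tendsto_intros limit(3))
  qed (use limit in auto)
qed

lemma abs_exp_mixture_power: "abs_exp_mixture f \<Longrightarrow> abs_exp_mixture (\<lambda>x. f x ^ k)"
  by (induction k) (auto intro: abs_exp_mixture_const abs_exp_mixture_mult)

lemma abs_exp_mixture_sum: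
  "(\<And>i. i \<in> I \<Longrightarrow> abs_exp_mixture (f i)) \<Longrightarrow> abs_exp_mixture (\<lambda>x. \<Sum>i\<in>I. f i x)"
  by (induction I rule: infinite_finite_induct)
    (auto intro: abs_exp_mixture_const abs_exp_mixture.add)

text \<open>The value of the series at \<open>c\<close> dominates all partial sums, so summability
  at this one point supplies both the uniform bound for the \<open>limit\<close> rule and, by
  comparison, convergence at every \<open>u x\<close>.\<close>

lemma abs_exp_mixture_power_series:
  assumes "\<And>k. a k \<ge> 0" "summable (\<lambda>k. a k * c ^ k)" "abs_exp_mixture u" "\<And>x. u x \<le> c"
  shows "abs_exp_mixture (\<lambda>x. \<Sum>k. a k * u x ^ k)"
proof (rule abs_exp_mixture.limit[where F = "\<lambda>n x. \<Sum>k<n. a k * u x ^ k" and B = "\<Sum>k. a k * c ^ k"])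
  have u: "0 \<le> u x" for x using abs_exp_mixture_nonneg[OF assms(3)] .
  have c: "0 \<le> c" using u assms(4) order.trans by blast
  have le: "a k * u x ^ k \<le> a k * c ^ k" for k x
    using assms(1) u assms(4) by (intro mult_left_mono power_mono) auto
  show "abs_exp_mixture (\<lambda>x. \<Sum>k<n. a k * u x ^ k)" for n
    by (intro abs_exp_mixture_sum abs_exp_mixture.scale assms abs_exp_mixture_power)
  show "(\<Sum>k<n. a k * u x ^ k) \<le> (\<Sum>k. a k * c ^ k)" for n x
    by (rule order.trans[OF sum_mono[OF le] sum_le_suminf]) (use assms c in auto)
  have "summable (\<lambda>k. a k * u x ^ k)" for x
    by (rule summable_comparison_test'[OF assms(2), of 0]) (use le assms(1) u in auto)
  then show "(\<lambda>n. \<Sum>k<n. a k * u x ^ k) \<longlonglongrightarrow> (\<Sum>k. a k * u x ^ k)" for x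
    by (rule summable_LIMSEQ)
qed

lemma abs_exp_mixture_exp:
  assumes "abs_exp_mixture u"
  shows "abs_exp_mixture (\<lambda>x. exp (u x))"
proof -
  obtain c where c: "\<And>x. u x \<le> c" using abs_exp_mixture_bounded[OF assms] by blast
  have "abs_exp_mixture (\<lambda>x. \<Sum>k. (1 / fact k) * u x ^ k)"
    using summable_exp[of c] by (intro abs_exp_mixture_power_series[OF _ _ assms c]) (auto simp: field_simps)
  moreover have "(\<Sum>k. (1 / fact k) * u x ^ k) = exp (u x)" for x
    by (simp add: exp_def divide_inverse)
  ultimately show ?thesis by simp
qed

section \<open>Signs of the coefficients of binomial series\<close>

lemma gbinomial_nonpos_sign:
  fixes q :: real
  assumes "q \<le> 0"
  shows "(q gchoose k) * (-1) ^ k \<ge> 0"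
proof -
  \<comment> \<open>The signs cancel: what remains is the rising factorial of \<open>- q\<close>, a
    product of nonnegative factors. These numbers are the coefficients of
    \<open>(1 - z) powr q\<close>.\<close>
  have "(q gchoose k) * (-1) ^ k = (-1) ^ k * (-1) ^ k * pochhammer (- q) k / fact k"
    by (simp add: gbinomial_pochhammer)
  also have "\<dots> = pochhammer (- q) k / fact k"
    by (simp flip: power_add)
  also have "\<dots> \<ge> 0" using assms by (cases "q = 0") (auto simp: pochhammer_0_left intro!: pochhammer_nonneg divide_nonneg_nonneg)
  finally show ?thesis .
qed

text \<open>Absorption lowers the upper index to \<open>r - 1 \<le> 0\<close>, where the previous
  sign rule applies. Consequently every coefficient of \<open>1 - (1 - z) powr r\<close> is
  nonnegative.\<close>

lemma gbinomial_unit_interval_sign: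
  fixes r :: real
  assumes "0 \<le> r" "r \<le> 1"
  shows "(r gchoose Suc k) * (-1) ^ k \<ge> 0"
proof -
  have "(r gchoose Suc k) = r / of_nat (Suc k) * ((r - 1) gchoose k)"
    using gbinomial_absorption'[of "Suc k" r] by simp
  then have "(r gchoose Suc k) * (-1) ^ k = r / of_nat (Suc k) * (((r - 1) gchoose k) * (-1) ^ k)"
    by simp
  also have "\<dots> \<ge> 0" by (intro mult_nonneg_nonneg gbinomial_nonpos_sign) (use assms in auto)
  finally show ?thesis .
qed

lemma one_minus_powr_sums:
  fixes a z :: real
  assumes "\<bar>z\<bar> < 1"
  shows "(\<lambda>k. (a gchoose k) * (-1) ^ k * z ^ k) sums (1 - z) powr a"
  using gen_binomial_real[of "- z" a] assms by (simp add: power_minus[of z] mult.assoc)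

text \<open>The discretisation of \<open>\<bar>x\<bar> + \<epsilon>\<close> that turns powers of it into binomial series in \<open>exp (- (\<bar>x\<bar> + \<epsilon>) / n)\<close>.\<close>

definition exp_step :: "real \<Rightarrow> nat \<Rightarrow> real \<Rightarrow> real" where
  "exp_step \<epsilon> n x = exp (- (\<bar>x\<bar> + \<epsilon>) / real (Suc n))"

lemma exp_step_pos: "exp_step \<epsilon> n x > 0"
  by (simp add: exp_step_def)

text \<open>The right-hand side is the value at \<open>x = 0\<close> and lies below 1 when
  \<epsilon> is positive, which keeps the binomial series away from its singularity at 1 uniformly
  in \<open>x\<close>.\<close>

lemma exp_step_le: "exp_step \<epsilon> n x \<le> exp (- \<epsilon> / real (Suc n))"
  by (simp add: exp_step_def field_simps)

lemma abs_exp_mixture_exp_step: "abs_exp_mixture (exp_step \<epsilon> n)"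
proof -
  have "exp_step \<epsilon> n = (\<lambda>x. exp (- \<epsilon> / real (Suc n)) * exp (- (1 / real (Suc n)) * \<bar>x\<bar>))"
    by (rule ext) (simp add: exp_step_def add_divide_distrib diff_divide_distrib flip: exp_add)
  then show ?thesis by (simp only:) (intro abs_exp_mixture.scale abs_exp_mixture.exp; simp)
qed

lemma abs_exp_mixture_one_minus_powr:
  assumes "q \<le> 0" "\<epsilon> > 0"
  shows "abs_exp_mixture (\<lambda>x. (1 - exp_step \<epsilon> n x) powr q)"
proof -
  define c where "c = exp (- \<epsilon> / real (Suc n))"
  have c: "0 < c" "c < 1" using assms by (auto simp: c_def)
  have u: "\<bar>exp_step \<epsilon> n x\<bar> < 1" for x
    using exp_step_pos[of \<epsilon> n x] exp_step_le[of \<epsilon> n x] c unfolding c_def by linarith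
  have "(\<Sum>k. (q gchoose k) * (-1) ^ k * exp_step \<epsilon> n x ^ k) = (1 - exp_step \<epsilon> n x) powr q" for x
    using one_minus_powr_sums[OF u] by (rule sums_unique[symmetric])
  moreover have "abs_exp_mixture (\<lambda>x. \<Sum>k. (q gchoose k) * (-1) ^ k * exp_step \<epsilon> n x ^ k)"
  proof (rule abs_exp_mixture_power_series)
    show "summable (\<lambda>k. (q gchoose k) * (-1) ^ k * c ^ k)"
      by (rule sums_summable[OF one_minus_powr_sums]) (use c in auto)
  qed (use gbinomial_nonpos_sign assms abs_exp_mixture_exp_step exp_step_le in \<open>auto simp: c_def\<close>)
  ultimately show ?thesis by simp
qed

text \<open>Since \<open>- (s * (1 - z) powr r) = - s + s * (1 - (1 - z) powr r)\<close>, the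
  exponent is a constant plus a power series with nonnegative coefficients. The exponential of the
  series is again a mixture, and the constant contributes the factor
  \<open>exp (- s)\<close>.\<close>

lemma abs_exp_mixture_exp_minus_powr:
  assumes "0 \<le> r" "r \<le> 1" "\<epsilon> > 0" "s \<ge> 0"
  shows "abs_exp_mixture (\<lambda>x. exp (- (s * (1 - exp_step \<epsilon> n x) powr r)))"
proof -
  define c where "c = exp (- \<epsilon> / real (Suc n))"
  define a where "a = (\<lambda>k. (r gchoose Suc k) * (-1) ^ k)"
  have c: "0 < c" "c < 1" using assms by (auto simp: c_def)
  have u: "\<bar>exp_step \<epsilon> n x\<bar> < 1" for x
    using exp_step_pos[of \<epsilon> n x] exp_step_le[of \<epsilon> n x] c unfolding c_def by linarith
  \<comment> \<open>Dividing by \<open>z\<close> shifts the series, whose constant term vanishes, to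
    start at index 0 with coefficients \<open>a\<close>. The condition \<open>z \<noteq> 0\<close>
    holds at \<open>exp_step\<close>, which is positive.\<close>
  have sums: "(\<lambda>k. a k * z ^ k) sums ((1 - (1 - z) powr r) / z)" if z: "\<bar>z\<bar> < 1" "z \<noteq> 0" for z
  proof -
    have "(\<lambda>k. (r gchoose Suc k) * (-1) ^ Suc k * z ^ Suc k) sums ((1 - z) powr r - 1)"
      using one_minus_powr_sums[OF z(1), of r] by (subst sums_Suc_iff) simp
    then have "(\<lambda>k. - 1 / z * ((r gchoose Suc k) * (-1) ^ Suc k * z ^ Suc k)) sums
        (- 1 / z * ((1 - z) powr r - 1))"
      by (rule sums_mult)
    also have "(\<lambda>k. - 1 / z * ((r gchoose Suc k) * (-1) ^ Suc k * z ^ Suc k)) = (\<lambda>k. a k * z ^ k)"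
      using z by (simp add: a_def mult.assoc)
    also have "- 1 / z * ((1 - z) powr r - 1) = (1 - (1 - z) powr r) / z"
      using z by (simp add: field_simps)
    finally show ?thesis .
  qed
  have "abs_exp_mixture (\<lambda>x. \<Sum>k. a k * exp_step \<epsilon> n x ^ k)"
  proof (rule abs_exp_mixture_power_series)
    show "summable (\<lambda>k. a k * c ^ k)"
      by (rule sums_summable[OF sums]) (use c in auto)
    show "a k \<ge> 0" for k unfolding a_def using gbinomial_unit_interval_sign assms by blast
  qed (use abs_exp_mixture_exp_step exp_step_le in \<open>auto simp: c_def\<close>)
  \<comment> \<open>The factor \<open>exp_step\<close> restores the power of \<open>z\<close> that
    the division removed.\<close>
  from abs_exp_mixture_mult[OF abs_exp_mixture_exp_step this, of \<epsilon> n]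
  have "abs_exp_mixture (\<lambda>x. 1 - (1 - exp_step \<epsilon> n x) powr r)"
    using exp_step_pos[of \<epsilon> n] by (simp add: sums_unique[OF sums[OF u], symmetric] less_imp_neq[THEN not_sym])
  from abs_exp_mixture.scale[OF exp_ge_zero abs_exp_mixture_exp[OF abs_exp_mixture.scale[OF assms(4) this]], of "- s"]
  show ?thesis by (simp add: algebra_simps flip: exp_add)
qed

text \<open>For \<open>z = (\<bar>x\<bar> + \<epsilon>) / (n + 1)\<close> these are the estimates
  \<open>1 - z \<le> exp (- z)\<close> and \<open>exp (- z) \<le> 1 / (1 + z)\<close>, rearranged
  and multiplied by \<open>n + 1\<close>. Both bounding expressions have the limit
  \<open>\<bar>x\<bar> + \<epsilon>\<close>.\<close>

lemma rescaled_exp_step_bounds: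
  assumes "\<epsilon> > 0"
  shows "real (Suc n) * (1 - exp_step \<epsilon> n x) \<le> \<bar>x\<bar> + \<epsilon>"
    and "(\<bar>x\<bar> + \<epsilon>) / (1 + (\<bar>x\<bar> + \<epsilon>) / real (Suc n)) \<le> real (Suc n) * (1 - exp_step \<epsilon> n x)"
proof -
  define z where "z = (\<bar>x\<bar> + \<epsilon>) / real (Suc n)"
  have z: "z > 0" and y: "\<bar>x\<bar> + \<epsilon> = real (Suc n) * z" using assms by (simp_all add: z_def)
  have e: "exp_step \<epsilon> n x = exp (- z)" by (simp add: exp_step_def z_def minus_divide_left)
  have "1 - exp (- z) \<le> z" using exp_ge_add_one_self[of "- z"] by simp
  then show "real (Suc n) * (1 - exp_step \<epsilon> n x) \<le> \<bar>x\<bar> + \<epsilon>"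
    unfolding e y by (intro mult_left_mono) auto
  have "exp (- z) \<le> 1 / (1 + z)"
    using exp_ge_add_one_self[of z] z by (simp add: exp_minus field_simps)
  then have "z / (1 + z) \<le> 1 - exp (- z)" using z by (simp add: field_simps)
  from mult_left_mono[OF this, of "real (Suc n)"]
  show "(\<bar>x\<bar> + \<epsilon>) / (1 + (\<bar>x\<bar> + \<epsilon>) / real (Suc n)) \<le> real (Suc n) * (1 - exp_step \<epsilon> n x)"
    unfolding e y by (simp del: of_nat_Suc)
qed

text \<open>A positive lower bound free of \<open>x\<close> and \<open>n\<close>: the quotient
  \<open>y / (1 + y)\<close> increases in \<open>y \<ge> \<epsilon>\<close>, and dividing by
  \<open>n + 1\<close> inside the denominator only shrinks it. A nonpositive power turns this into a
  uniform upper bound.\<close>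

lemma rescaled_exp_step_ge:
  assumes "\<epsilon> > 0"
  shows "\<epsilon> / (1 + \<epsilon>) \<le> real (Suc n) * (1 - exp_step \<epsilon> n x)"
proof -
  define y where "y = \<bar>x\<bar> + \<epsilon>"
  have y: "y \<ge> \<epsilon>" by (simp add: y_def)
  have "\<epsilon> / (1 + \<epsilon>) \<le> y / (1 + y)" using y assms by (simp add: field_simps)
  also have "\<dots> \<le> y / (1 + y / real (Suc n))"
    using y assms by (intro divide_left_mono mult_pos_pos add_left_mono add_pos_nonneg)
      (auto simp: divide_le_eq mult_le_cancel_left1)
  also have "\<dots> \<le> real (Suc n) * (1 - exp_step \<epsilon> n x)"
    using rescaled_exp_step_bounds(2)[OF assms] by (simp add: y_def)
  finally show ?thesis .
qed

text \<open>The shift may vary with \<open>n\<close>: a constant sequence serves the negative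
  powers, and \<open>1 / (n + 1)\<close> serves the functions
  \<open>exp (- rpow \<bar>x\<bar> r)\<close>.\<close>

lemma rescaled_exp_step_tendsto:
  assumes "\<And>n. \<epsilon> n > 0" "\<epsilon> \<longlonglongrightarrow> e"
  shows "(\<lambda>n. real (Suc n) * (1 - exp_step (\<epsilon> n) n x)) \<longlonglongrightarrow> \<bar>x\<bar> + e"
proof (rule tendsto_sandwich[rotated 2])
  have "(\<lambda>n. (\<bar>x\<bar> + \<epsilon> n) * (1 / real (Suc n))) \<longlonglongrightarrow> (\<bar>x\<bar> + e) * 0"
    by (intro tendsto_mult tendsto_intros assms LIMSEQ_Suc[OF lim_1_over_n])
  then have "(\<lambda>n. (\<bar>x\<bar> + \<epsilon> n) / real (Suc n)) \<longlonglongrightarrow> 0" by simp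
  then have "(\<lambda>n. (\<bar>x\<bar> + \<epsilon> n) / (1 + (\<bar>x\<bar> + \<epsilon> n) / real (Suc n))) \<longlonglongrightarrow> (\<bar>x\<bar> + e) / (1 + 0)"
    by (intro tendsto_intros assms) auto
  then show "(\<lambda>n. (\<bar>x\<bar> + \<epsilon> n) / (1 + (\<bar>x\<bar> + \<epsilon> n) / real (Suc n))) \<longlonglongrightarrow> \<bar>x\<bar> + e" by simp
  show "(\<lambda>n. \<bar>x\<bar> + \<epsilon> n) \<longlonglongrightarrow> \<bar>x\<bar> + e" by (intro tendsto_intros assms)
qed (intro always_eventually allI rescaled_exp_step_bounds assms)+

text \<open>The factor \<open>n + 1\<close> leaves the power as the nonnegative scalar
  \<open>(n + 1) powr q\<close>. Since \<open>q \<le> 0\<close>, the uniform lower bound on the base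
  becomes the upper bound that the \<open>limit\<close> rule asks for.\<close>

lemma abs_exp_mixture_powr:
  assumes "q \<le> 0" "\<epsilon> > 0"
  shows "abs_exp_mixture (\<lambda>x. (\<bar>x\<bar> + \<epsilon>) powr q)"
proof (rule abs_exp_mixture.limit)
  let ?y = "\<lambda>n x. real (Suc n) * (1 - exp_step \<epsilon> n x)"
  have pos: "?y n x > 0" for n x
    by (rule less_le_trans[OF _ rescaled_exp_step_ge[OF assms(2)]]) (use assms in simp)
  have "?y n x powr q = real (Suc n) powr q * (1 - exp_step \<epsilon> n x) powr q" for n x
    by (rule powr_mult)
  then show "abs_exp_mixture (\<lambda>x. ?y n x powr q)" for n
    by (auto intro!: abs_exp_mixture.scale abs_exp_mixture_one_minus_powr assms simp del: of_nat_Suc)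
  show "?y n x powr q \<le> (\<epsilon> / (1 + \<epsilon>)) powr q" for n x
    by (rule powr_mono2'[OF assms(1) _ rescaled_exp_step_ge[OF assms(2)]]) (use assms in simp)
  show "(\<lambda>n. ?y n x powr q) \<longlonglongrightarrow> (\<bar>x\<bar> + \<epsilon>) powr q" for x
    by (intro tendsto_powr rescaled_exp_step_tendsto tendsto_const) (use assms in auto)
qed

text \<open>A positive power is continuous at 0, so the shift \<open>1 / (n + 1)\<close> disappears
  in the same limit as the discretisation, and 1 is a uniform bound. The exponent 0 stands apart
  because \<open>rpow 0 0 = 1\<close> while \<open>0 powr 0 = 0\<close>.\<close>

lemma abs_exp_mixture_exp_rpow:
  assumes "0 \<le> r" "r \<le> 1"
  shows "abs_exp_mixture (\<lambda>x. exp (- rpow \<bar>x\<bar> r))"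
proof (cases "r = 0")
  case True
  then show ?thesis by (simp add: rpow_def abs_exp_mixture_const)
next
  case False
  then have r: "r > 0" using assms by simp
  define \<epsilon> where "\<epsilon> = (\<lambda>n. 1 / real (Suc n))"
  have \<epsilon>: "\<And>n. \<epsilon> n > 0" "\<epsilon> \<longlonglongrightarrow> 0"
    unfolding \<epsilon>_def using LIMSEQ_Suc[OF lim_1_over_n] by (auto simp del: of_nat_Suc)
  let ?y = "\<lambda>n x. real (Suc n) * (1 - exp_step (\<epsilon> n) n x)"
  have pos: "?y n x > 0" for n x
    by (rule less_le_trans[OF _ rescaled_exp_step_ge[OF \<epsilon>(1)]]) (use \<epsilon>(1)[of n] in simp)
  have "abs_exp_mixture (\<lambda>x. exp (- (\<bar>x\<bar> powr r)))"
  proof (rule abs_exp_mixture.limit)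
    have "?y n x powr r = real (Suc n) powr r * (1 - exp_step (\<epsilon> n) n x) powr r" for n x
      by (rule powr_mult)
    then show "abs_exp_mixture (\<lambda>x. exp (- (?y n x powr r)))" for n
      by (auto intro!: abs_exp_mixture_exp_minus_powr assms \<epsilon>(1) simp del: of_nat_Suc)
    show "exp (- (?y n x powr r)) \<le> 1" for n x by simp
    have "(\<lambda>n. ?y n x powr r) \<longlonglongrightarrow> (\<bar>x\<bar> + 0) powr r" for x
      by (intro tendsto_powr2 rescaled_exp_step_tendsto \<epsilon> tendsto_const)
        (use r less_imp_le[OF pos] in auto)
    then show "(\<lambda>n. exp (- (?y n x powr r))) \<longlonglongrightarrow> exp (- (\<bar>x\<bar> powr r))" for x
      by (simp del: of_nat_Suc add: tendsto_exp tendsto_minus)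
  qed
  then show ?thesis using False by (simp add: rpow_def)
qed

subsection \<open>Fischer's determinant inequality\<close>

text \<open>Matrices are handled as functions of two indices, of which only those below
  \<open>n\<close> count. Passing to a Schur complement is then a shift of indices, without carrier
  conditions.\<close>

definition quad_form :: "nat \<Rightarrow> (nat \<Rightarrow> nat \<Rightarrow> real) \<Rightarrow> (nat \<Rightarrow> real) \<Rightarrow> real" where
  "quad_form n f v = (\<Sum>i<n. \<Sum>j<n. v i * f i j * v j)"

definition sym_fun :: "nat \<Rightarrow> (nat \<Rightarrow> nat \<Rightarrow> real) \<Rightarrow> bool" where
  "sym_fun n f \<longleftrightarrow> (\<forall>i<n. \<forall>j<n. f i j = f j i)"

definition psd_fun :: "nat \<Rightarrow> (nat \<Rightarrow> nat \<Rightarrow> real) \<Rightarrow> bool" where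
  "psd_fun n f \<longleftrightarrow> sym_fun n f \<and> (\<forall>v. quad_form n f v \<ge> 0)"

definition pd_fun :: "nat \<Rightarrow> (nat \<Rightarrow> nat \<Rightarrow> real) \<Rightarrow> bool" where
  "pd_fun n f \<longleftrightarrow> sym_fun n f \<and> (\<forall>v. (\<exists>i<n. v i \<noteq> 0) \<longrightarrow> quad_form n f v > 0)"

definition det_fun :: "nat \<Rightarrow> (nat \<Rightarrow> nat \<Rightarrow> real) \<Rightarrow> real" where
  "det_fun n f = Determinant.det (Matrix.mat n n (\<lambda>(i, j). f i j))"

definition schur_compl :: "(nat \<Rightarrow> nat \<Rightarrow> real) \<Rightarrow> nat \<Rightarrow> nat \<Rightarrow> real" where
  "schur_compl f i j = f (Suc i) (Suc j) - f (Suc i) 0 * f 0 (Suc j) / f 0 0"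

lemma det_fun_0 [simp]: "det_fun 0 f = 1"
  by (simp add: det_fun_def)

text \<open>One elimination step: \<open>E\<close> is unit lower triangular and clears the first
  column below the pivot, so \<open>E * F\<close> is block upper triangular with the Schur
  complement in the lower right corner.\<close>

lemma det_fun_schur_compl:
  assumes "f 0 0 \<noteq> 0"
  shows "det_fun (Suc n) f = f 0 0 * det_fun n (schur_compl f)"
proof -
  define E :: "real mat" where
    "E = four_block_mat (1\<^sub>m 1) (0\<^sub>m 1 n) (Matrix.mat n 1 (\<lambda>(i, j). - f (Suc i) 0 / f 0 0)) (1\<^sub>m n)"
  define F where "F = Matrix.mat (Suc n) (Suc n) (\<lambda>(i, j). f i j)"
  define G where "G = four_block_mat (Matrix.mat 1 1 (\<lambda>(i, j). f 0 0))
    (Matrix.mat 1 n (\<lambda>(i, j). f 0 (Suc j))) (0\<^sub>m n 1) (Matrix.mat n n (\<lambda>(i, j). schur_compl f i j))"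
  have F: "F = four_block_mat (Matrix.mat 1 1 (\<lambda>(i, j). f 0 0)) (Matrix.mat 1 n (\<lambda>(i, j). f 0 (Suc j)))
     (Matrix.mat n 1 (\<lambda>(i, j). f (Suc i) 0)) (Matrix.mat n n (\<lambda>(i, j). f (Suc i) (Suc j)))"
    unfolding F_def by (rule eq_matI) (auto simp: less_Suc_eq_0_disj)
  have E: "E \<in> carrier_mat (Suc n) (Suc n)"
    unfolding E_def using four_block_carrier_mat[of "1\<^sub>m 1" 1 1 "1\<^sub>m n" n n] by simp
  have "E * F = G"
    unfolding E_def F G_def
    by (subst mult_four_block_mat[where ?nr1.0 = 1 and ?n1.0 = 1 and ?n2.0 = n and ?nr2.0 = n and ?nc1.0 = 1 and ?nc2.0 = n])
      (auto intro!: arg_cong4[of _ _ _ _ _ _ _ _ four_block_mat] eq_matI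
        simp: scalar_prod_def schur_compl_def assms)
  moreover have "Determinant.det E = 1"
    unfolding E_def by (subst det_four_block_mat_upper_right_zero[where n = 1 and m = n]) auto
  moreover have "Determinant.det G = f 0 0 * det_fun n (schur_compl f)"
    unfolding G_def det_fun_def
    by (subst det_four_block_mat_lower_left_zero[where n = 1 and m = n]) (auto simp: det_single)
  moreover have "Determinant.det (E * F) = Determinant.det E * Determinant.det F"
    by (rule det_mult[OF E]) (simp add: F_def)
  ultimately show ?thesis by (simp add: det_fun_def F_def)
qed

text \<open>Completing the square in \<open>v 0\<close>. By symmetry the first row and the first
  column contribute equal cross terms, and the square they produce is exactly what the Schur
  complement subtracts.\<close>

lemma quad_form_Suc:
  assumes "sym_fun (Suc n) f" "f 0 0 \<noteq> 0"
  shows "quad_form (Suc n) f v =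
    f 0 0 * (v 0 + (\<Sum>i<n. f 0 (Suc i) * v (Suc i)) / f 0 0)\<^sup>2 +
    quad_form n (schur_compl f) (\<lambda>i. v (Suc i))"
proof -
  define s where "s = (\<Sum>i<n. f 0 (Suc i) * v (Suc i))"
  have sym: "f (Suc i) 0 = f 0 (Suc i)" if "i < n" for i
    using assms(1) that by (simp add: sym_fun_def)
  have "quad_form (Suc n) f v = f 0 0 * (v 0)\<^sup>2 + v 0 * s +
    (\<Sum>i<n. v (Suc i) * f (Suc i) 0 * v 0) + (\<Sum>i<n. \<Sum>j<n. v (Suc i) * f (Suc i) (Suc j) * v (Suc j))"
    unfolding quad_form_def s_def
    by (simp add: sum.lessThan_Suc_shift sum.distrib sum_distrib_left power2_eq_square algebra_simps del: sum.lessThan_Suc)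
  also have "(\<Sum>i<n. v (Suc i) * f (Suc i) 0 * v 0) = v 0 * s"
    unfolding s_def by (simp add: sum_distrib_left sym mult_ac)
  also have "(\<Sum>i<n. \<Sum>j<n. v (Suc i) * f (Suc i) (Suc j) * v (Suc j)) =
     quad_form n (schur_compl f) (\<lambda>i. v (Suc i)) +
     (\<Sum>i<n. \<Sum>j<n. v (Suc i) * (f (Suc i) 0 * f 0 (Suc j) / f 0 0) * v (Suc j))"
    unfolding quad_form_def schur_compl_def by (simp add: algebra_simps flip: sum.distrib)
  also have "(\<Sum>i<n. \<Sum>j<n. v (Suc i) * (f (Suc i) 0 * f 0 (Suc j) / f 0 0) * v (Suc j)) = s * s / f 0 0"
    unfolding s_def sum_product sum_divide_distrib by (intro sum.cong refl) (simp add: sym mult_ac)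
  finally show ?thesis
    unfolding s_def[symmetric] using assms(2) by (simp add: power2_eq_square field_simps)
qed

lemma quad_form_add: "quad_form n (\<lambda>i j. f i j + g i j) v = quad_form n f v + quad_form n g v"
  by (simp add: quad_form_def algebra_simps sum.distrib)

lemma sym_fun_schur_compl: "sym_fun (Suc n) f \<Longrightarrow> sym_fun n (schur_compl f)"
  by (auto simp: sym_fun_def schur_compl_def)

lemma sym_fun_add: "sym_fun n f \<Longrightarrow> sym_fun n g \<Longrightarrow> sym_fun n (\<lambda>i j. f i j + g i j)"
  by (auto simp: sym_fun_def)

lemma pd_fun_add: "pd_fun n f \<Longrightarrow> psd_fun n g \<Longrightarrow> pd_fun n (\<lambda>i j. f i j + g i j)"
  by (auto simp: pd_fun_def psd_fun_def sym_fun_add quad_form_add intro: add_pos_nonneg)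

lemma pd_funD: "pd_fun n f \<Longrightarrow> i < n \<Longrightarrow> v i \<noteq> 0 \<Longrightarrow> quad_form n f v > 0"
  by (auto simp: pd_fun_def)

lemma pd_fun_pivot_pos:
  assumes "pd_fun (Suc n) f"
  shows "f 0 0 > 0"
proof -
  define v :: "nat \<Rightarrow> real" where "v i = (if i = 0 then 1 else 0)" for i
  have "quad_form (Suc n) f v = f 0 0"
    by (simp add: quad_form_def v_def sum.lessThan_Suc_shift del: sum.lessThan_Suc)
  moreover have "quad_form (Suc n) f v > 0"
    using assms by (auto simp: pd_fun_def v_def)
  ultimately show ?thesis by simp
qed

text \<open>Completing the square: the Schur complement is the minimum of the form over the first coordinate.\<close>

lemma quad_form_minimizer:
  assumes "sym_fun (Suc n) f" "f 0 0 \<noteq> 0"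
  obtains c where "quad_form (Suc n) f (case_nat c v) = quad_form n (schur_compl f) v"
  by (rule that[of "- (\<Sum>i<n. f 0 (Suc i) * v i) / f 0 0"]) (simp add: quad_form_Suc[OF assms])

lemma quad_form_schur_compl_le:
  assumes "sym_fun (Suc n) f" "f 0 0 > 0"
  shows "quad_form n (schur_compl f) v \<le> quad_form (Suc n) f (case_nat c v)"
  using quad_form_Suc[OF assms(1), of "case_nat c v"] assms(2) by simp

text \<open>A nonzero \<open>v\<close> extends by the minimising first coordinate to a nonzero
  vector on which the form of \<open>f\<close> takes the value of the Schur complement at
  \<open>v\<close>.\<close>

lemma pd_fun_schur_compl:
  assumes "pd_fun (Suc n) f"
  shows "pd_fun n (schur_compl f)"
proof -
  have f: "sym_fun (Suc n) f" "f 0 0 > 0"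
    using assms pd_fun_pivot_pos by (auto simp: pd_fun_def)
  have "quad_form n (schur_compl f) v > 0" if v: "\<exists>i<n. v i \<noteq> 0" for v
  proof -
    obtain c where c: "quad_form (Suc n) f (case_nat c v) = quad_form n (schur_compl f) v"
      using quad_form_minimizer[of n f v] f by auto
    from v obtain i where "i < n" "v i \<noteq> 0" by blast
    then have "\<exists>i<Suc n. case_nat c v i \<noteq> 0" by (intro exI[of _ "Suc i"]) auto
    then show ?thesis using assms unfolding c[symmetric] pd_fun_def by blast
  qed
  then show ?thesis using sym_fun_schur_compl[OF f(1)] by (auto simp: pd_fun_def)
qed

lemma det_fun_pos: "pd_fun n f \<Longrightarrow> det_fun n f > 0"
proof (induction n arbitrary: f)
  case (Suc n)
  have "f 0 0 > 0" using pd_fun_pivot_pos[OF Suc.prems] .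
  with Suc.IH[OF pd_fun_schur_compl[OF Suc.prems]] show ?case
    by (simp add: det_fun_schur_compl)
qed simp

text \<open>The determinant is the pivot times the determinant of the Schur complement, and both
  grow with the matrix: the pivot is a value of the form, the Schur complement a minimum of such
  values. Its growth \<open>k\<close> is therefore positive semidefinite, and the induction
  hypothesis applies.\<close>

lemma det_fun_mono:
  "pd_fun n f \<Longrightarrow> psd_fun n h \<Longrightarrow> det_fun n f \<le> det_fun n (\<lambda>i j. f i j + h i j)"
proof (induction n arbitrary: f h)
  case (Suc n)
  define g where "g = (\<lambda>i j. f i j + h i j)"
  define k where "k = (\<lambda>i j. schur_compl g i j - schur_compl f i j)"
  have g: "pd_fun (Suc n) g" unfolding g_def using pd_fun_add Suc.prems by blast
  have pos: "f 0 0 > 0" "g 0 0 > 0" using pd_fun_pivot_pos g Suc.prems by blast+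
  have sym: "sym_fun (Suc n) f" "sym_fun (Suc n) g" using g Suc.prems by (auto simp: pd_fun_def)
  have "quad_form n k v \<ge> 0" for v
  proof -
    \<comment> \<open>\<open>c\<close> is the minimiser for \<open>g\<close>, not for
      \<open>f\<close>: the form of \<open>f\<close> at this point is at least its own minimum and
      at most the form of \<open>g\<close>.\<close>
    obtain c where c: "quad_form (Suc n) g (case_nat c v) = quad_form n (schur_compl g) v"
      using quad_form_minimizer[OF sym(2)] pos by auto
    have "quad_form n (schur_compl f) v \<le> quad_form (Suc n) f (case_nat c v)"
      by (rule quad_form_schur_compl_le[OF sym(1) pos(1)])
    also have "\<dots> \<le> quad_form (Suc n) g (case_nat c v)"
      unfolding g_def quad_form_add using Suc.prems(2) by (auto simp: psd_fun_def)
    also have "\<dots> = quad_form n (\<lambda>i j. schur_compl f i j + k i j) v"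
      unfolding c by (simp add: k_def)
    finally show ?thesis unfolding quad_form_add by simp
  qed
  moreover have "sym_fun n k"
    using sym_fun_schur_compl[OF sym(1)] sym_fun_schur_compl[OF sym(2)]
    by (auto simp: sym_fun_def k_def)
  ultimately have "psd_fun n k" by (simp add: psd_fun_def)
  then have "det_fun n (schur_compl f) \<le> det_fun n (\<lambda>i j. schur_compl f i j + k i j)"
    by (rule Suc.IH[OF pd_fun_schur_compl[OF Suc.prems(1)]])
  also have "(\<lambda>i j. schur_compl f i j + k i j) = schur_compl g" by (simp add: k_def)
  finally have *: "det_fun n (schur_compl f) \<le> det_fun n (schur_compl g)" .
  have "f 0 0 \<le> g 0 0"
  proof -
    have "psd_fun (Suc n) h" by fact
    then have "quad_form (Suc n) h (\<lambda>i. if i = 0 then 1 else 0) \<ge> 0" by (simp add: psd_fun_def)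
    then have "h 0 0 \<ge> 0"
      by (simp add: quad_form_def sum.lessThan_Suc_shift del: sum.lessThan_Suc)
    then show ?thesis by (simp add: g_def)
  qed
  with * show ?case
    using det_fun_pos[OF pd_fun_schur_compl[OF Suc.prems(1)]] pos
    unfolding g_def[symmetric] by (simp add: det_fun_schur_compl mult_mono)
qed simp

text \<open>The principal submatrix on \<open>S\<close>, padded with the identity instead of
  renumbered: its determinant is the principal minor, and both factors in Fischer's inequality keep
  the size \<open>n\<close>.\<close>

definition compress :: "nat set \<Rightarrow> (nat \<Rightarrow> nat \<Rightarrow> real) \<Rightarrow> nat \<Rightarrow> nat \<Rightarrow> real" where
  "compress S f i j = (if i \<in> S \<and> j \<in> S then f i j else if i = j then 1 else 0)"

lemma quad_form_compress:
  "quad_form n (compress S f) v =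
    quad_form n f (\<lambda>i. if i \<in> S then v i else 0) + (\<Sum>i<n. if i \<in> S then 0 else (v i)\<^sup>2)"
proof -
  have "v i * compress S f i j * v j = (if i \<in> S then v i else 0) * f i j * (if j \<in> S then v j else 0) +
      (if j = i then if i \<in> S then 0 else (v i)\<^sup>2 else 0)" for i j
    by (simp add: compress_def power2_eq_square)
  then show ?thesis by (simp add: quad_form_def sum.distrib sum.delta)
qed

lemma pd_fun_compress:
  assumes "pd_fun n f"
  shows "pd_fun n (compress S f)"
proof -
  have "quad_form n (compress S f) v > 0" if v: "i < n" "v i \<noteq> 0" for v i
  proof (cases "i \<in> S")
    case True
    have "quad_form n f (\<lambda>i. if i \<in> S then v i else 0) > 0"
      by (rule pd_funD[OF assms v(1)]) (use v True in simp)
    moreover have "(\<Sum>i<n. if i \<in> S then 0 else (v i)\<^sup>2) \<ge> 0" by (intro sum_nonneg) auto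
    ultimately show ?thesis unfolding quad_form_compress by simp
  next
    case False
    have "quad_form n f w \<ge> 0" for w
    proof (cases "\<exists>i<n. w i \<noteq> 0")
      case False
      then show ?thesis by (simp add: quad_form_def)
    qed (use assms in \<open>auto simp: pd_fun_def less_imp_le\<close>)
    moreover have "(\<Sum>i<n. if i \<in> S then 0 else (v i)\<^sup>2) > 0"
      by (rule sum_pos2[of _ i]) (use v False in auto)
    ultimately show ?thesis unfolding quad_form_compress by (simp add: add_nonneg_pos)
  qed
  moreover have "sym_fun n (compress S f)"
    using assms by (auto simp: pd_fun_def sym_fun_def compress_def)
  ultimately show ?thesis by (auto simp: pd_fun_def)
qed

text \<open>For \<open>0 \<in> S\<close>, elimination of the first index commutes with compression
  to \<open>S\<close>. In the complement the index 0 is decoupled, so elimination there leaves the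
  original tail block, which exceeds the compressed Schur complement by a rank-one positive
  semidefinite term; monotonicity of the determinant absorbs it.\<close>

lemma fischer_inequality:
  "pd_fun n f \<Longrightarrow> det_fun n f \<le> det_fun n (compress S f) * det_fun n (compress (- S) f)"
proof (induction n arbitrary: f S)
  case (Suc n)
  \<comment> \<open>Exchanging \<open>S\<close> with its complement only swaps the two factors, so
    the case \<open>0 \<in> S\<close> decides both.\<close>
  have step: "det_fun (Suc n) f \<le> det_fun (Suc n) (compress S f) * det_fun (Suc n) (compress (- S) f)"
    if S: "0 \<in> S" for S
  proof -
    define T where "T = {i. Suc i \<in> S}"
    define tail where "tail = (\<lambda>i j. f (Suc i) (Suc j))"
    \<comment> \<open>The term that the Schur complement subtracts, restricted to the indices
      outside \<open>T\<close>. Its quadratic form is a square divided by the pivot.\<close>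
    define h where "h = (\<lambda>i j. if i \<notin> T \<and> j \<notin> T then f (Suc i) 0 * f 0 (Suc j) / f 0 0 else 0)"
    have pos: "f 0 0 > 0" using pd_fun_pivot_pos[OF Suc.prems] .
    note pd = pd_fun_schur_compl[OF Suc.prems]
    have sym: "f (Suc i) 0 = f 0 (Suc i)" if "i < n" for i
      using Suc.prems that by (simp add: pd_fun_def sym_fun_def)
    have "schur_compl (compress S f) = compress T (schur_compl f)"
      using S by (intro ext) (auto simp: schur_compl_def compress_def T_def)
    then have 1: "det_fun (Suc n) (compress S f) = f 0 0 * det_fun n (compress T (schur_compl f))"
      using S pos by (subst det_fun_schur_compl) (auto simp: compress_def)
    have "schur_compl (compress (- S) f) = compress (- T) tail"
      using S by (intro ext) (auto simp: schur_compl_def compress_def T_def tail_def)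
    then have 2: "det_fun (Suc n) (compress (- S) f) = det_fun n (compress (- T) tail)"
      using S by (subst det_fun_schur_compl) (auto simp: compress_def)
    have "quad_form n h v = (\<Sum>i<n. if i \<notin> T then f 0 (Suc i) * v i else 0)\<^sup>2 / f 0 0" for v
      unfolding quad_form_def power2_eq_square sum_product sum_divide_distrib
      by (intro sum.cong refl) (auto simp: h_def sym)
    then have "psd_fun n h"
      using pos sym by (auto simp: psd_fun_def sym_fun_def h_def)
    from det_fun_mono[OF pd_fun_compress[OF pd] this, of "- T"]
    have "det_fun n (compress (- T) (schur_compl f)) \<le>
        det_fun n (\<lambda>i j. compress (- T) (schur_compl f) i j + h i j)" .
    also have "(\<lambda>i j. compress (- T) (schur_compl f) i j + h i j) = compress (- T) tail"
      by (intro ext) (auto simp: compress_def schur_compl_def h_def tail_def)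
    finally have 3: "det_fun n (compress (- T) (schur_compl f)) \<le> det_fun n (compress (- T) tail)" .
    have "det_fun (Suc n) f = f 0 0 * det_fun n (schur_compl f)"
      using pos by (simp add: det_fun_schur_compl)
    also have "\<dots> \<le> f 0 0 * (det_fun n (compress T (schur_compl f)) * det_fun n (compress (- T) (schur_compl f)))"
      using Suc.IH[OF pd, of T] pos by simp
    also have "\<dots> \<le> f 0 0 * (det_fun n (compress T (schur_compl f)) * det_fun n (compress (- T) tail))"
      using 3 pos det_fun_pos[OF pd_fun_compress[OF pd], of T] by simp
    finally show ?thesis unfolding 1 2 by (simp add: mult.assoc)
  qed
  show ?case
  proof (cases "0 \<in> S")
    case False
    then show ?thesis using step[of "- S"] by (simp add: mult.commute)
  qed (rule step)
qed simp


section \<open>The determinant in the Laplace transform\<close>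

lemma det_one_plus_mult_commute:
  fixes A B :: "'a :: idom mat"
  assumes A: "A \<in> carrier_mat n n" and B: "B \<in> carrier_mat n n"
  shows "Determinant.det (1\<^sub>m n + A * B) = Determinant.det (1\<^sub>m n + B * A)"
proof -
  \<comment> \<open>Sylvester's identity by computing the determinant of \<open>P\<close> twice.
    Multiplying by the unipotent \<open>Q\<close> clears the upper right block and leaves
    \<open>1\<^sub>m n + B * A\<close>; the block formula, valid since the lower blocks
    \<open>B\<close> and \<open>1\<^sub>m n\<close> commute, gives
    \<open>1\<^sub>m n + A * B\<close>.\<close>
  define P where "P = four_block_mat (1\<^sub>m n) (- A) B (1\<^sub>m n)"
  define Q where "Q = four_block_mat (1\<^sub>m n) A (0\<^sub>m n n) (1\<^sub>m n)"
  define R where "R = four_block_mat (1\<^sub>m n) (0\<^sub>m n n) B (1\<^sub>m n + B * A)"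
  have P: "P \<in> carrier_mat (n + n) (n + n)" and Q: "Q \<in> carrier_mat (n + n) (n + n)"
    unfolding P_def Q_def by (intro four_block_carrier_mat; simp)+
  have "P * Q = R"
    unfolding P_def Q_def R_def
    by (subst mult_four_block_mat[where ?nr1.0 = n and ?n1.0 = n and ?n2.0 = n and ?nr2.0 = n and ?nc1.0 = n and ?nc2.0 = n])
      (use A B in \<open>auto intro!: arg_cong4[of _ _ _ _ _ _ _ _ four_block_mat] comm_add_mat[of _ n n]
         simp: uminus_l_inv_mat add_uminus_minus_mat\<close>)
  moreover have "Determinant.det Q = 1"
    unfolding Q_def by (subst det_four_block_mat_lower_left_zero[where n = n and m = n]) (use A in auto)
  moreover have "Determinant.det R = Determinant.det (1\<^sub>m n + B * A)"
    unfolding R_def by (subst det_four_block_mat_upper_right_zero[where n = n and m = n]) (use A B in auto)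
  moreover have "Determinant.det P = Determinant.det (1\<^sub>m n + A * B)"
  proof -
    have "Determinant.det P = Determinant.det (1\<^sub>m n * 1\<^sub>m n - (- A) * B)"
      unfolding P_def by (rule det_four_block_mat) (use A B in auto)
    also have "1\<^sub>m n * 1\<^sub>m n - (- A) * B = 1\<^sub>m n + A * B"
      using A B by (intro eq_matI) auto
    finally show ?thesis .
  qed
  ultimately show ?thesis using det_mult[OF P Q] by simp
qed

lemma psd_mat_quad_form:
  assumes "psd_mat n A"
  shows "psd_fun n (\<lambda>i j. A $$ (i, j))"
proof -
  have A: "A \<in> carrier_mat n n" "transpose_mat A = A" using assms by (auto simp: psd_mat_def)
  have "quad_form n (\<lambda>i j. A $$ (i, j)) v = scalar_prod (Matrix.vec n v) (A *\<^sub>v Matrix.vec n v)" for v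
    using A by (simp add: quad_form_def scalar_prod_def sum_distrib_left mult.assoc lessThan_atLeast0)
  moreover have "A $$ (i, j) = A $$ (j, i)" if "i < n" "j < n" for i j
    using A that by (metis carrier_matD index_transpose_mat(1))
  ultimately show ?thesis
    using assms by (auto simp: psd_fun_def psd_mat_def sym_fun_def)
qed

text \<open>The entries of \<open>1\<^sub>m n + R * \<Sigma> * R\<close>, where \<open>R\<close> is
  the diagonal matrix of the square roots of \<tau>. Unlike
  \<open>1\<^sub>m n + R * R * \<Sigma>\<close> it inherits symmetry from \<Sigma>, so the results
  on quadratic forms apply.\<close>

definition scaled_plus_one :: "(nat \<Rightarrow> real) \<Rightarrow> real mat \<Rightarrow> nat \<Rightarrow> nat \<Rightarrow> real" where
  "scaled_plus_one \<tau> \<Sigma> i j = (if i = j then 1 else 0) + sqrt (\<tau> i) * \<Sigma> $$ (i, j) * sqrt (\<tau> j)"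

lemma det_one_plus_diag_mult:
  assumes "\<Sigma> \<in> carrier_mat n n" "\<And>i. i < n \<Longrightarrow> \<tau> i \<ge> 0"
  shows "Determinant.det (1\<^sub>m n + Matrix.mat n n (\<lambda>(i, j). if i = j then \<tau> i else 0) * \<Sigma>) =
    det_fun n (scaled_plus_one \<tau> \<Sigma>)"
proof -
  define R where "R = Matrix.mat n n (\<lambda>(i, j). if i = j then sqrt (\<tau> i) else 0)"
  have R: "R \<in> carrier_mat n n" by (simp add: R_def)
  have "Matrix.mat n n (\<lambda>(i, j). if i = j then \<tau> i else 0) = R * R"
    using assms(2) by (intro eq_matI) (auto simp: R_def scalar_prod_def if_distrib[where f = "\<lambda>x. x * _"] if_distrib[where f = "\<lambda>x. _ * x"] sum.delta cong: if_cong)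
  then have "Matrix.mat n n (\<lambda>(i, j). if i = j then \<tau> i else 0) * \<Sigma> = R * (R * \<Sigma>)"
    using assoc_mult_mat[OF R R assms(1)] by simp
  then have "Determinant.det (1\<^sub>m n + Matrix.mat n n (\<lambda>(i, j). if i = j then \<tau> i else 0) * \<Sigma>) =
      Determinant.det (1\<^sub>m n + R * \<Sigma> * R)"
    using det_one_plus_mult_commute[OF R, of "R * \<Sigma>"] R assms(1) by auto
  also have "1\<^sub>m n + R * \<Sigma> * R = Matrix.mat n n (\<lambda>(i, j). scaled_plus_one \<tau> \<Sigma> i j)"
    using assms(1) by (intro eq_matI) (auto simp: R_def scaled_plus_one_def scalar_prod_def if_distrib[where f = "\<lambda>x. x * _"] if_distrib[where f = "\<lambda>x. _ * x"] sum.delta cong: if_cong)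
  finally show ?thesis by (simp add: det_fun_def)
qed

lemma pd_fun_one: "pd_fun n (\<lambda>i j. if i = j then 1 else 0)"
proof -
  have "quad_form n (\<lambda>i j. if i = j then 1 else 0) v = (\<Sum>i<n. (v i)\<^sup>2)" for v
    by (simp add: quad_form_def if_distrib[where f = "\<lambda>x. x * _"] if_distrib[where f = "\<lambda>x. _ * x"] sum.delta power2_eq_square cong: if_cong)
  moreover have "(\<Sum>i<n. (v i)\<^sup>2) > 0" if "i < n" "v i \<noteq> 0" for v :: "nat \<Rightarrow> real" and i
    by (rule sum_pos2[of _ i]) (use that in auto)
  ultimately show ?thesis by (auto simp: pd_fun_def sym_fun_def)
qed

lemma det_fun_one: "det_fun n (\<lambda>i j. if i = j then 1 else 0) = 1"
proof -
  have "Matrix.mat n n (\<lambda>(i, j). if i = j then 1 else 0 :: real) = 1\<^sub>m n"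
    by (rule eq_matI) auto
  then show ?thesis by (simp add: det_fun_def)
qed

lemma psd_fun_scaled:
  assumes "psd_fun n f"
  shows "psd_fun n (\<lambda>i j. c i * f i j * c j)"
proof -
  have "quad_form n (\<lambda>i j. c i * f i j * c j) v = quad_form n f (\<lambda>i. c i * v i)" for v
    by (simp add: quad_form_def mult_ac)
  then show ?thesis using assms by (auto simp: psd_fun_def sym_fun_def)
qed

lemma
  assumes "psd_mat n \<Sigma>"
  shows pd_fun_scaled_plus_one: "pd_fun n (scaled_plus_one \<tau> \<Sigma>)"
    and det_fun_scaled_plus_one_ge_1: "det_fun n (scaled_plus_one \<tau> \<Sigma>) \<ge> 1"
proof -
  have eq: "scaled_plus_one \<tau> \<Sigma> =
      (\<lambda>i j. (if i = j then 1 else 0) + sqrt (\<tau> i) * \<Sigma> $$ (i, j) * sqrt (\<tau> j))"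
    by (intro ext) (simp add: scaled_plus_one_def)
  note psd = psd_fun_scaled[OF psd_mat_quad_form[OF assms], of "\<lambda>i. sqrt (\<tau> i)"]
  show "pd_fun n (scaled_plus_one \<tau> \<Sigma>)"
    unfolding eq by (rule pd_fun_add[OF pd_fun_one psd])
  show "det_fun n (scaled_plus_one \<tau> \<Sigma>) \<ge> 1"
    unfolding eq using det_fun_mono[OF pd_fun_one psd] by (simp add: det_fun_one)
qed

text \<open>An index of weight 0 contributes a row and a column of the identity. Hence the minors in
  Fischer's inequality are determinants at arguments \<open>t\<close> with some coordinates set to
  0, that is, they belong to Laplace transforms of subvectors.\<close>

lemma compress_scaled_plus_one:
  "compress S (scaled_plus_one \<tau> \<Sigma>) = scaled_plus_one (\<lambda>i. if i \<in> S then \<tau> i else 0) \<Sigma>"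
  by (intro ext) (auto simp: compress_def scaled_plus_one_def)

text \<open>\<open>b xs\<close> records for every row the block containing it. The block diagonal
  matrix thereby becomes an ordinary diagonal matrix, whose square root can be taken
  entrywise.\<close>

lemma diag_block_mat_scalar_blocks:
  fixes p :: "nat \<Rightarrow> nat"
  defines "b \<equiv> \<lambda>xs. concat (map (\<lambda>i. replicate (p i) i) xs)"
  shows "diag_block_mat (map (\<lambda>i. t i \<cdot>\<^sub>m 1\<^sub>m (p i)) xs) =
    Matrix.mat (length (b xs)) (length (b xs)) (\<lambda>(i, j). if i = j then t (b xs ! i) else 0 :: real)"
proof (induction xs)
  case (Cons x xs)
  show ?case
    unfolding list.map diag_block_mat.simps Let_def Cons.IH
    by (rule eq_matI) (auto simp: b_def nth_append)
qed (auto simp: b_def)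

text \<open>Fischer's inequality is applied to the rows whose block index lies in \<open>J\<close>.
  The exponent \<open>- \<alpha> \<le> 0\<close> reverses it, and multiplicativity of powers
  separates the factors; all determinants involved are at least 1.\<close>

lemma trace_wishart_laplace:
  fixes X :: "nat \<Rightarrow> 'a \<Rightarrow> real"
  defines "L \<equiv> \<lambda>M d t. \<integral>\<^sup>+ \<omega>. ennreal (exp (- (\<Sum>i = 1..d. t i * X i \<omega>))) \<partial>M"
  assumes "trace_wishart M d p \<alpha> \<Sigma> X" "psd_mat (\<Sum>i = 1..d. p i) \<Sigma>" "\<alpha> \<ge> 0"
    and t: "\<And>i. i \<in> {1..d} \<Longrightarrow> t i \<ge> 0"
  shows trace_wishart_laplace_le_1: "L M d t \<le> 1"
    and trace_wishart_laplace_assoc: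
      "L M d (\<lambda>i. if i \<in> J then t i else 0) * L M d (\<lambda>i. if i \<in> J then 0 else t i) \<le> L M d t"
proof -
  define b where "b = concat (map (\<lambda>i. replicate (p i) i) [1..<d + 1])"
  define n where "n = (\<Sum>i = 1..d. p i)"
  define D where "D = (\<lambda>t. det_fun n (scaled_plus_one (\<lambda>i. t (b ! i)) \<Sigma>))"
  have n: "length b = n"
    by (simp add: b_def n_def length_concat comp_def interv_sum_list_conv_sum_set_nat atLeastLessThanSuc_atLeastAtMost del: upt_Suc)
  have b: "b ! i \<in> {1..d}" if "i < n" for i
    using nth_mem[of i b] that n unfolding b_def by auto
  have \<Sigma>: "\<Sigma> \<in> carrier_mat n n" using assms by (simp add: psd_mat_def n_def)
  have L: "L M d s = ennreal (D s powr (- \<alpha>))" if s: "\<And>i. i \<in> {1..d} \<Longrightarrow> s i \<ge> 0" for s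
  proof -
    have "L M d s = ennreal (Determinant.det (1\<^sub>m n +
        diag_block_mat (map (\<lambda>i. s i \<cdot>\<^sub>m 1\<^sub>m (p i)) [1..<d + 1]) * \<Sigma>) powr (- \<alpha>))"
      using assms(2) s unfolding trace_wishart_def L_def n_def by blast
    also have "diag_block_mat (map (\<lambda>i. s i \<cdot>\<^sub>m 1\<^sub>m (p i)) [1..<d + 1]) =
        Matrix.mat n n (\<lambda>(i, j). if i = j then s (b ! i) else 0)"
      using diag_block_mat_scalar_blocks[of s p "[1..<d + 1]"] unfolding b_def[symmetric] n by simp
    finally show ?thesis
      unfolding D_def using det_one_plus_diag_mult[OF \<Sigma>, of "\<lambda>i. s (b ! i)"] s b by simp
  qed
  have ge: "D s \<ge> 1" for s
    unfolding D_def using det_fun_scaled_plus_one_ge_1 assms(3) n_def by blast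
  show "L M d t \<le> 1"
  proof -
    have "D t powr (- \<alpha>) \<le> 1"
      using ge[of t] assms(4) powr_mono2'[of "- \<alpha>" 1 "D t"] by simp
    moreover have "L M d t = ennreal (D t powr (- \<alpha>))" by (rule L) (rule t)
    ultimately show ?thesis by simp
  qed
  let ?t1 = "\<lambda>i. if i \<in> J then t i else 0" and ?t2 = "\<lambda>i. if i \<in> J then 0 else t i"
  have "D t \<le> D ?t1 * D ?t2"
  proof -
    have *: "compress {i. b ! i \<in> J} (scaled_plus_one (\<lambda>i. t (b ! i)) \<Sigma>) =
         scaled_plus_one (\<lambda>i. if b ! i \<in> J then t (b ! i) else 0) \<Sigma>"
      "compress (- {i. b ! i \<in> J}) (scaled_plus_one (\<lambda>i. t (b ! i)) \<Sigma>) =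
         scaled_plus_one (\<lambda>i. if b ! i \<in> J then 0 else t (b ! i)) \<Sigma>"
      unfolding compress_scaled_plus_one by (auto intro!: arg_cong[where f = "\<lambda>x. scaled_plus_one x \<Sigma>"])
    show ?thesis
      unfolding D_def *[symmetric]
      by (rule fischer_inequality[OF pd_fun_scaled_plus_one]) (use assms(3) in \<open>simp add: n_def\<close>)
  qed
  then have "(D ?t1 * D ?t2) powr (- \<alpha>) \<le> D t powr (- \<alpha>)"
    using ge[of t] assms(4) by (intro powr_mono2') auto
  then have "ennreal (D ?t1 powr (- \<alpha>)) * ennreal (D ?t2 powr (- \<alpha>)) \<le> ennreal (D t powr (- \<alpha>))"
    by (simp add: powr_mult ennreal_leI flip: ennreal_mult)
  then show "L M d ?t1 * L M d ?t2 \<le> L M d t"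
    using t by (subst (1 2 3) L) auto
qed

subsection \<open>Association inequalities for mixtures\<close>

context prob_space
begin

lemma abs_exp_mixture_integral_nonneg:
  assumes Z [measurable]: "Z \<in> borel_measurable M" and H [measurable]: "H \<in> borel_measurable M"
    and bound: "\<And>\<omega>. \<bar>H \<omega>\<bar> \<le> K"
    and exp: "\<And>t. t \<ge> 0 \<Longrightarrow> (\<integral>\<omega>. exp (- t * \<bar>Z \<omega>\<bar>) * H \<omega> \<partial>M) \<ge> 0"
    and g: "abs_exp_mixture g"
  shows "(\<integral>\<omega>. g (Z \<omega>) * H \<omega> \<partial>M) \<ge> 0"
proof -
  have K: "K \<ge> 0" using bound abs_ge_zero order.trans by blast
  have int: "integrable M (\<lambda>\<omega>. g (Z \<omega>) * H \<omega>)" if g: "abs_exp_mixture g" for g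
  proof -
    obtain B where B: "\<And>x. g x \<le> B" using abs_exp_mixture_bounded[OF g] by blast
    note [measurable] = abs_exp_mixture_measurable[OF g]
    show ?thesis
      by (rule integrable_const_bound[where B = "B * K"])
        (use B bound K abs_exp_mixture_nonneg[OF g] in
          \<open>auto simp: abs_mult intro!: mult_mono AE_I2 intro: order.trans\<close>)
  qed
  show ?thesis
    using g
  proof (induction rule: abs_exp_mixture.induct)
    case (exp t)
    then show ?case using assms(4) by simp
  next
    case (add f g)
    then show ?case using int by (simp add: distrib_right)
  next
    case (scale c f)
    then show ?case by (simp add: mult.assoc)
  next
    case (limit F B f)
    have [measurable]: "F n \<in> borel_measurable borel" "f \<in> borel_measurable borel" for n
      by (rule abs_exp_mixture_measurable[OF limit(1)])
        (rule abs_exp_mixture_measurable[OF abs_exp_mixture.limit[OF limit(1-3)]])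
    have "(\<lambda>n. \<integral>\<omega>. F n (Z \<omega>) * H \<omega> \<partial>M) \<longlonglongrightarrow> (\<integral>\<omega>. f (Z \<omega>) * H \<omega> \<partial>M)"
    proof (rule integral_dominated_convergence[where w = "\<lambda>_. B * K"])
      show "AE \<omega> in M. (\<lambda>n. F n (Z \<omega>) * H \<omega>) \<longlonglongrightarrow> f (Z \<omega>) * H \<omega>"
        by (intro AE_I2 tendsto_intros limit(3))
      have "0 \<le> B" using limit(2) abs_exp_mixture_nonneg[OF limit(1)] order.trans by blast
      then show "AE \<omega> in M. norm (F n (Z \<omega>) * H \<omega>) \<le> B * K" for n
        using limit(2) bound K abs_exp_mixture_nonneg[OF limit(1)]
        by (auto simp: abs_mult intro!: mult_mono AE_I2)
    qed auto
    then show ?case by (rule LIMSEQ_le_const) (use limit(4) in auto)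
  qed
qed

lemma prod_abs_exp_mixture_bounded:
  assumes "\<And>i. i \<in> I \<Longrightarrow> abs_exp_mixture (f i)"
  obtains B where "B \<ge> 0" "\<And>\<omega>. 0 \<le> (\<Prod>i\<in>I. f i (Z i \<omega>))" "\<And>\<omega>. (\<Prod>i\<in>I. f i (Z i \<omega>)) \<le> B"
proof -
  from assms have "\<forall>i\<in>I. \<exists>B\<ge>0. \<forall>x. f i x \<le> B"
    using abs_exp_mixture_bounded by blast
  then obtain B where B: "\<And>i. i \<in> I \<Longrightarrow> B i \<ge> 0 \<and> (\<forall>x. f i x \<le> B i)" by metis
  show ?thesis
    by (rule that[of "\<Prod>i\<in>I. B i"])
      (use B abs_exp_mixture_nonneg[OF assms] in \<open>auto intro!: prod_nonneg prod_mono\<close>)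
qed

definition pos_assoc :: "('i \<Rightarrow> 'a \<Rightarrow> real) \<Rightarrow> 'i set \<Rightarrow> 'i set \<Rightarrow> ('i \<Rightarrow> real \<Rightarrow> real) \<Rightarrow> bool" where
  "pos_assoc Z I J f \<longleftrightarrow>
    (\<integral>\<omega>. (\<Prod>i\<in>I. f i (Z i \<omega>)) \<partial>M) * (\<integral>\<omega>. (\<Prod>i\<in>J. f i (Z i \<omega>)) \<partial>M) \<le>
    (\<integral>\<omega>. (\<Prod>i\<in>I \<union> J. f i (Z i \<omega>)) \<partial>M)"

lemma pos_assoc_commute: "pos_assoc Z I J f \<longleftrightarrow> pos_assoc Z J I f"
  by (simp add: pos_assoc_def Un_commute mult.commute)

text \<open>With the other factors frozen, the difference of the two sides is the integral of
  \<open>h (Z k \<omega>)\<close> against the weight \<open>U \<omega> - W * V \<omega>\<close>. It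
  is linear in \<open>h\<close> because \<open>k\<close> lies in \<open>I\<close> alone, which makes
  the expectation \<open>W\<close> over \<open>J\<close> a constant.\<close>

lemma pos_assoc_update:
  assumes fin: "finite I" "finite J" and disj: "I \<inter> J = {}" and k: "k \<in> I"
    and Z: "\<And>i. i \<in> I \<union> J \<Longrightarrow> Z i \<in> borel_measurable M"
    and f: "\<And>i. i \<in> I \<union> J \<Longrightarrow> abs_exp_mixture (f i)"
    and exp: "\<And>t. t \<ge> 0 \<Longrightarrow> pos_assoc Z I J (f(k := \<lambda>x. exp (- t * \<bar>x\<bar>)))"
    and g: "abs_exp_mixture g"
  shows "pos_assoc Z I J (f(k := g))"
proof -
  define U where "U \<omega> = (\<Prod>i\<in>I \<union> J - {k}. f i (Z i \<omega>))" for \<omega>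
  define V where "V \<omega> = (\<Prod>i\<in>I - {k}. f i (Z i \<omega>))" for \<omega>
  define W where "W = (\<integral>\<omega>. (\<Prod>i\<in>J. f i (Z i \<omega>)) \<partial>M)"
  have kJ: "k \<notin> J" using disj k by auto
  have Zf: "(\<lambda>\<omega>. f i (Z i \<omega>)) \<in> borel_measurable M" if "i \<in> I \<union> J" for i
    using measurable_compose[OF Z[OF that] abs_exp_mixture_measurable[OF f[OF that]]] .
  have [measurable]: "U \<in> borel_measurable M" "V \<in> borel_measurable M"
    unfolding U_def V_def by (auto intro!: borel_measurable_prod Zf)
  have Zk [measurable]: "Z k \<in> borel_measurable M" using Z k by auto
  obtain BU where BU: "BU \<ge> 0" "\<And>\<omega>. 0 \<le> U \<omega>" "\<And>\<omega>. U \<omega> \<le> BU"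
    using prod_abs_exp_mixture_bounded[of "I \<union> J - {k}" f Z] f unfolding U_def by (metis DiffD1)
  obtain BV where BV: "BV \<ge> 0" "\<And>\<omega>. 0 \<le> V \<omega>" "\<And>\<omega>. V \<omega> \<le> BV"
    using prod_abs_exp_mixture_bounded[of "I - {k}" f Z] f unfolding V_def by (metis DiffD1 UnI1)
  have iff: "pos_assoc Z I J (f(k := h)) \<longleftrightarrow> (\<integral>\<omega>. h (Z k \<omega>) * (U \<omega> - W * V \<omega>) \<partial>M) \<ge> 0"
    if h: "abs_exp_mixture h" for h
  proof -
    obtain B where B: "B \<ge> 0" "\<And>x. h x \<le> B" using abs_exp_mixture_bounded[OF h] by blast
    note [measurable] = abs_exp_mixture_measurable[OF h]
    have int: "integrable M (\<lambda>\<omega>. h (Z k \<omega>) * U \<omega>)" "integrable M (\<lambda>\<omega>. h (Z k \<omega>) * V \<omega>)"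
      by (rule integrable_const_bound[where B = "B * BU"] integrable_const_bound[where B = "B * BV"];
          use B BU BV abs_exp_mixture_nonneg[OF h] in \<open>auto simp: abs_mult intro!: mult_mono AE_I2\<close>)+
    have "(\<Prod>i\<in>I \<union> J. (f(k := h)) i (Z i \<omega>)) = h (Z k \<omega>) * U \<omega>" for \<omega>
      using fin k unfolding U_def by (subst prod.remove[of _ k]) auto
    moreover have "(\<Prod>i\<in>I. (f(k := h)) i (Z i \<omega>)) = h (Z k \<omega>) * V \<omega>" for \<omega>
      using fin k unfolding V_def by (subst prod.remove[of _ k]) auto
    moreover have "(\<Prod>i\<in>J. (f(k := h)) i (Z i \<omega>)) = (\<Prod>i\<in>J. f i (Z i \<omega>))" for \<omega>
      using kJ by (intro prod.cong) auto
    moreover have "(\<integral>\<omega>. h (Z k \<omega>) * (U \<omega> - W * V \<omega>) \<partial>M) =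
        (\<integral>\<omega>. h (Z k \<omega>) * U \<omega> \<partial>M) - W * (\<integral>\<omega>. h (Z k \<omega>) * V \<omega> \<partial>M)"
      using int by (simp add: right_diff_distrib mult.left_commute[of _ W])
    ultimately show ?thesis by (simp add: pos_assoc_def W_def mult.commute)
  qed
  have "\<bar>U \<omega> - W * V \<omega>\<bar> \<le> BU + \<bar>W\<bar> * BV" for \<omega>
  proof -
    have "\<bar>W * V \<omega>\<bar> \<le> \<bar>W\<bar> * BV" using BV by (simp add: abs_mult mult_left_mono)
    then show ?thesis using BU(2,3)[of \<omega>] by linarith
  qed
  from abs_exp_mixture_integral_nonneg[OF Zk _ this _ g] show ?thesis
    unfolding iff[OF g] using exp iff[OF abs_exp_mixture.exp] by simp
qed

text \<open>The inequality is linear in each factor separately, so it passes from exponentials to mixtures one coordinate at a time.\<close>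

lemma pos_assoc_mixture:
  assumes fin: "finite I" "finite J" and disj: "I \<inter> J = {}"
    and Z: "\<And>i. i \<in> I \<union> J \<Longrightarrow> Z i \<in> borel_measurable M"
    and f: "\<And>i. i \<in> I \<union> J \<Longrightarrow> abs_exp_mixture (f i)"
    and exp: "\<And>t. (\<And>i. t i \<ge> 0) \<Longrightarrow> pos_assoc Z I J (\<lambda>i x. exp (- t i * \<bar>x\<bar>))"
  shows "pos_assoc Z I J f"
proof -
  \<comment> \<open>The rates \<open>t\<close> stay arbitrary in the induction: to replace the
    factor at \<open>k\<close>, the claim must already hold with every rate \<open>s\<close> at
    \<open>k\<close>.\<close>
  have "pos_assoc Z I J (\<lambda>i. if i \<in> K then f i else (\<lambda>x. exp (- t i * \<bar>x\<bar>)))"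
    if "finite K" "K \<subseteq> I \<union> J" "\<And>i. t i \<ge> 0" for K t
    using that
  proof (induction K arbitrary: t)
    case empty
    then show ?case using exp by simp
  next
    case (insert k K)
    let ?h = "\<lambda>i. if i \<in> K then f i else (\<lambda>x. exp (- t i * \<bar>x\<bar>))"
    have h: "abs_exp_mixture (?h i)" if "i \<in> I \<union> J" for i
      using f[OF that] insert.prems(2) abs_exp_mixture.exp[of "t i"] by simp
    have "pos_assoc Z I J (?h(k := \<lambda>x. exp (- s * \<bar>x\<bar>)))" if "s \<ge> 0" for s
    proof -
      have "?h(k := \<lambda>x. exp (- s * \<bar>x\<bar>)) =
          (\<lambda>i. if i \<in> K then f i else (\<lambda>x. exp (- (t(k := s)) i * \<bar>x\<bar>)))"
        using insert.hyps(2) by auto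
      then show ?thesis
        using insert.IH[of "t(k := s)"] insert.prems that by auto
    qed
    note exp_k = this
    have "pos_assoc Z I J (?h(k := f k))"
    proof (cases "k \<in> I")
      case True
      show ?thesis
        by (rule pos_assoc_update[OF fin disj True Z h exp_k f]) (use True in auto)
    next
      case False
      then have k: "k \<in> J" using insert.prems(1) by auto
      \<comment> \<open>\<open>pos_assoc_update\<close> changes a coordinate of its first index set;
        for \<open>k\<close> in \<open>J\<close> the two sets trade places.\<close>
      have "pos_assoc Z J I (?h(k := f k))"
        by (rule pos_assoc_update[OF fin(2,1) _ k Z h exp_k[THEN pos_assoc_commute[THEN iffD1]] f])
          (use k disj in auto)
      then show ?thesis by (rule pos_assoc_commute[THEN iffD1])
    qed
    moreover have "?h(k := f k) = (\<lambda>i. if i \<in> insert k K then f i else (\<lambda>x. exp (- t i * \<bar>x\<bar>)))"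
      by auto
    ultimately show ?case by simp
  qed
  from this[of "I \<union> J" "\<lambda>_. 0"] fin
  have *: "pos_assoc Z I J (\<lambda>i. if i \<in> I \<union> J then f i else (\<lambda>x. exp (- 0 * \<bar>x\<bar>)))" by simp
  have "(\<Prod>i\<in>S. (if i \<in> I \<union> J then f i else (\<lambda>x. exp (- 0 * \<bar>x\<bar>))) (Z i \<omega>)) =
      (\<Prod>i\<in>S. f i (Z i \<omega>))" if "S \<subseteq> I \<union> J" for S \<omega>
    by (intro prod.cong refl) (use that in auto)
  note eq = this[OF Un_upper1] this[OF Un_upper2] this[OF order.refl]
  show ?thesis using * unfolding pos_assoc_def eq .
qed

section \<open>Nonnegativity and association of trace-Wishart vectors\<close>

lemma AE_nonneg_of_laplace_le_1:
  assumes [measurable]: "Y \<in> borel_measurable M"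
    and "\<And>t. t \<ge> 0 \<Longrightarrow> (\<integral>\<^sup>+ \<omega>. ennreal (exp (- (t * Y \<omega>))) \<partial>M) \<le> 1"
  shows "AE \<omega> in M. Y \<omega> \<ge> 0"
proof -
  \<comment> \<open>\<open>ennreal\<close> truncates at 0, so \<open>c\<close> is the expected
    negative part of \<open>Y\<close>. From \<open>u \<le> exp u\<close> at
    \<open>u = - (n * Y \<omega>)\<close> comes \<open>n * c \<le> 1\<close> for all
    \<open>n\<close>, which forces \<open>c = 0\<close>.\<close>
  define c where "c = (\<integral>\<^sup>+ \<omega>. ennreal (- Y \<omega>) \<partial>M)"
  have le: "of_nat n * c \<le> 1" for n
  proof -
    have "of_nat n * c = (\<integral>\<^sup>+ \<omega>. of_nat n * ennreal (- Y \<omega>) \<partial>M)"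
      unfolding c_def by (simp add: nn_integral_cmult)
    also have "\<dots> \<le> (\<integral>\<^sup>+ \<omega>. ennreal (exp (- (real n * Y \<omega>))) \<partial>M)"
    proof (rule nn_integral_mono)
      fix \<omega>
      have "of_nat n * ennreal (- Y \<omega>) = ennreal (real n * (- Y \<omega>))"
        by (simp only: ennreal_of_nat_eq_real_of_nat ennreal_mult'[OF of_nat_0_le_iff])
      also have "\<dots> \<le> ennreal (exp (- (real n * Y \<omega>)))"
        using exp_ge_add_one_self[of "- (real n * Y \<omega>)"] by (intro ennreal_leI) simp
      finally show "of_nat n * ennreal (- Y \<omega>) \<le> ennreal (exp (- (real n * Y \<omega>)))" .
    qed
    also have "\<dots> \<le> 1" using assms(2)[of "real n"] by simp
    finally show ?thesis .
  qed
  have "c = 0"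
  proof (rule ccontr)
    assume "c \<noteq> 0"
    then have "(SUP n. of_nat n * c) = (Orderings.top :: ennreal)"
      by (simp add: ennreal_SUP_of_nat_eq_top ennreal_top_mult flip: SUP_mult_right_ennreal)
    moreover have "(SUP n. of_nat n * c) \<le> 1" using le by (intro SUP_least)
    ultimately have "(Orderings.top :: ennreal) \<le> 1" by (simp only:)
    then show False by (simp add: top_unique)
  qed
  then have "AE \<omega> in M. ennreal (- Y \<omega>) = 0"
    unfolding c_def by (subst (asm) nn_integral_0_iff_AE) auto
  then show ?thesis by (auto simp: ennreal_eq_0_iff)
qed

lemma trace_wishart_AE_nonneg:
  assumes "trace_wishart M d p \<alpha> \<Sigma> X" "psd_mat (\<Sum>i = 1..d. p i) \<Sigma>" "\<alpha> \<ge> 0"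
  shows "AE \<omega> in M. \<forall>i\<in>{1..d}. X i \<omega> \<ge> 0"
proof (rule AE_finite_allI)
  fix i assume i: "i \<in> {1..d}"
  show "AE \<omega> in M. X i \<omega> \<ge> 0"
  proof (rule AE_nonneg_of_laplace_le_1)
    show "X i \<in> borel_measurable M" using assms(1) i by (auto simp: trace_wishart_def)
    fix t :: real assume "t \<ge> 0"
    then show "(\<integral>\<^sup>+ \<omega>. ennreal (exp (- (t * X i \<omega>))) \<partial>M) \<le> 1"
      using trace_wishart_laplace_le_1[OF assms, of "\<lambda>j. if j = i then t else 0"] i
      by (simp add: if_distrib[where f = "\<lambda>x. x * _"] sum.delta cong: if_cong)
  qed
qed simp

text \<open>What the mixture lemma leaves open is the exponential case. Setting the rates outside
  \<open>S\<close> to 0 turns the joint Laplace transform into that of the coordinates in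
  \<open>S\<close>, and almost surely the absolute values change nothing.\<close>

lemma trace_wishart_pos_assoc:
  assumes tw: "trace_wishart M d p \<alpha> \<Sigma> X" "psd_mat (\<Sum>i = 1..d. p i) \<Sigma>" "\<alpha> \<ge> 0"
    and IJ: "I \<union> J = {1..d}" "I \<inter> J = {}"
    and f: "\<And>i. i \<in> {1..d} \<Longrightarrow> abs_exp_mixture (f i)"
  shows "pos_assoc X I J f"
proof (rule pos_assoc_mixture)
  have fin: "finite I" "finite J" using IJ by (metis finite_Un finite_atLeastAtMost)+
  then show "finite I" "finite J" by auto
  have X [measurable]: "X i \<in> borel_measurable M" if "i \<in> {1..d}" for i
    using tw(1) that by (auto simp: trace_wishart_def)
  then show "X i \<in> borel_measurable M" if "i \<in> I \<union> J" for i using that IJ(1) by simp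
  show "I \<inter> J = {}" by fact
  show "abs_exp_mixture (f i)" if "i \<in> I \<union> J" for i using that IJ(1) f by simp
  fix t :: "nat \<Rightarrow> real" assume t: "\<And>i. t i \<ge> 0"
  have L: "(\<integral>\<^sup>+ \<omega>. ennreal (exp (- (\<Sum>i = 1..d. s i * X i \<omega>))) \<partial>M) =
      ennreal (\<integral>\<omega>. (\<Prod>i\<in>S. exp (- t i * \<bar>X i \<omega>\<bar>)) \<partial>M)"
    if S: "S \<subseteq> {1..d}" and s: "\<And>i. i \<in> {1..d} \<Longrightarrow> s i = (if i \<in> S then t i else 0)" for S s
  proof -
    have [measurable]: "X i \<in> borel_measurable M" if "i \<in> S" for i using that S by auto
    have "(\<integral>\<^sup>+ \<omega>. ennreal (exp (- (\<Sum>i = 1..d. s i * X i \<omega>))) \<partial>M) =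
        (\<integral>\<^sup>+ \<omega>. ennreal (\<Prod>i\<in>S. exp (- t i * \<bar>X i \<omega>\<bar>)) \<partial>M)"
    proof (rule nn_integral_cong_AE)
      show "AE \<omega> in M. ennreal (exp (- (\<Sum>i = 1..d. s i * X i \<omega>))) =
          ennreal (\<Prod>i\<in>S. exp (- t i * \<bar>X i \<omega>\<bar>))"
        using trace_wishart_AE_nonneg[OF tw]
      proof eventually_elim
        case (elim \<omega>)
        have "(\<Sum>i = 1..d. s i * X i \<omega>) = (\<Sum>i\<in>S. s i * X i \<omega>)"
          using S s by (intro sum.mono_neutral_right) auto
        also have "\<dots> = (\<Sum>i\<in>S. t i * \<bar>X i \<omega>\<bar>)"
          using S s elim by (intro sum.cong) auto
        finally show ?case
          using finite_subset[OF S] by (simp add: exp_sum sum_negf[symmetric])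
      qed
    qed
    also have "\<dots> = ennreal (\<integral>\<omega>. (\<Prod>i\<in>S. exp (- t i * \<bar>X i \<omega>\<bar>)) \<partial>M)"
    proof (rule nn_integral_eq_integral)
      show "integrable M (\<lambda>\<omega>. \<Prod>i\<in>S. exp (- t i * \<bar>X i \<omega>\<bar>))"
        by (rule integrable_const_bound[where B = 1])
          (use t in \<open>auto intro!: AE_I2 prod_le_1 simp: abs_prod\<close>)
    qed (auto intro!: prod_nonneg)
    finally show ?thesis .
  qed
  have *: "ennreal (\<integral>\<omega>. (\<Prod>i\<in>I. exp (- t i * \<bar>X i \<omega>\<bar>)) \<partial>M) * ennreal (\<integral>\<omega>. (\<Prod>i\<in>J. exp (- t i * \<bar>X i \<omega>\<bar>)) \<partial>M) \<le>
      ennreal (\<integral>\<omega>. (\<Prod>i\<in>I \<union> J. exp (- t i * \<bar>X i \<omega>\<bar>)) \<partial>M)"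
  proof -
    have "(\<integral>\<^sup>+ \<omega>. ennreal (exp (- (\<Sum>i = 1..d. (if i \<in> I then t i else 0) * X i \<omega>))) \<partial>M) =
        ennreal (\<integral>\<omega>. (\<Prod>i\<in>I. exp (- t i * \<bar>X i \<omega>\<bar>)) \<partial>M)"
      "(\<integral>\<^sup>+ \<omega>. ennreal (exp (- (\<Sum>i = 1..d. (if i \<in> I then 0 else t i) * X i \<omega>))) \<partial>M) =
        ennreal (\<integral>\<omega>. (\<Prod>i\<in>J. exp (- t i * \<bar>X i \<omega>\<bar>)) \<partial>M)"
      "(\<integral>\<^sup>+ \<omega>. ennreal (exp (- (\<Sum>i = 1..d. t i * X i \<omega>))) \<partial>M) =
        ennreal (\<integral>\<omega>. (\<Prod>i\<in>I \<union> J. exp (- t i * \<bar>X i \<omega>\<bar>)) \<partial>M)"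
      by (rule L; use IJ in auto)+
    then show ?thesis
      using trace_wishart_laplace_assoc[OF tw, of t I] t by simp
  qed
  show "pos_assoc X I J (\<lambda>i x. exp (- t i * \<bar>x\<bar>))"
  proof -
    have "(\<integral>\<omega>. (\<Prod>i\<in>S. exp (- t i * \<bar>X i \<omega>\<bar>)) \<partial>M) \<ge> 0" for S
      by (intro Bochner_Integration.integral_nonneg prod_nonneg) auto
    note nonneg = this
    show ?thesis
      using * unfolding pos_assoc_def ennreal_mult[OF nonneg nonneg, symmetric] ennreal_le_iff[OF nonneg] .
  qed
qed

lemma nn_integral_prod_abs_exp_mixture:
  assumes "\<And>i. i \<in> I \<Longrightarrow> Z i \<in> borel_measurable M" "\<And>i. i \<in> I \<Longrightarrow> abs_exp_mixture (f i)"
  shows "(\<integral>\<^sup>+ \<omega>. ennreal (\<Prod>i\<in>I. f i (Z i \<omega>)) \<partial>M) = ennreal (\<integral>\<omega>. (\<Prod>i\<in>I. f i (Z i \<omega>)) \<partial>M)"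
    and "integrable M (\<lambda>\<omega>. \<Prod>i\<in>I. f i (Z i \<omega>))"
proof -
  obtain B where B: "B \<ge> 0" "\<And>\<omega>. 0 \<le> (\<Prod>i\<in>I. f i (Z i \<omega>))" "\<And>\<omega>. (\<Prod>i\<in>I. f i (Z i \<omega>)) \<le> B"
    by (rule prod_abs_exp_mixture_bounded[where I = I and f = f and Z = Z]) (erule assms(2), rule that)
  have "(\<lambda>\<omega>. \<Prod>i\<in>I. f i (Z i \<omega>)) \<in> borel_measurable M"
    by (intro borel_measurable_prod measurable_compose[OF assms(1) abs_exp_mixture_measurable[OF assms(2)]])
  then show int: "integrable M (\<lambda>\<omega>. \<Prod>i\<in>I. f i (Z i \<omega>))"
    by (intro integrable_const_bound[where B = B]) (use B in auto)
  then show "(\<integral>\<^sup>+ \<omega>. ennreal (\<Prod>i\<in>I. f i (Z i \<omega>)) \<partial>M) = ennreal (\<integral>\<omega>. (\<Prod>i\<in>I. f i (Z i \<omega>)) \<partial>M)"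
    by (rule nn_integral_eq_integral) (use B in auto)
qed

lemma trace_wishart_nn_integral_prod_le:
  assumes tw: "trace_wishart M d p \<alpha> \<Sigma> X" "psd_mat (\<Sum>i = 1..d. p i) \<Sigma>" "\<alpha> \<ge> 0"
    and IJ: "I \<union> J = {1..d}" "I \<inter> J = {}"
    and f: "\<And>i. i \<in> {1..d} \<Longrightarrow> abs_exp_mixture (f i)"
  shows "(\<integral>\<^sup>+ \<omega>. ennreal (\<Prod>i\<in>I. f i (X i \<omega>)) \<partial>M) * (\<integral>\<^sup>+ \<omega>. ennreal (\<Prod>i\<in>J. f i (X i \<omega>)) \<partial>M) \<le>
    (\<integral>\<^sup>+ \<omega>. ennreal (\<Prod>i\<in>{1..d}. f i (X i \<omega>)) \<partial>M)"
proof -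
  have X: "X i \<in> borel_measurable M" if "i \<in> {1..d}" for i
    using tw(1) that by (auto simp: trace_wishart_def)
  have eq: "(\<integral>\<^sup>+ \<omega>. ennreal (\<Prod>i\<in>S. f i (X i \<omega>)) \<partial>M) = ennreal (\<integral>\<omega>. (\<Prod>i\<in>S. f i (X i \<omega>)) \<partial>M)"
    if "S \<subseteq> {1..d}" for S
    using that by (intro nn_integral_prod_abs_exp_mixture X f) auto
  have "(\<integral>\<omega>. (\<Prod>i\<in>S. f i (X i \<omega>)) \<partial>M) \<ge> 0" if "S \<subseteq> {1..d}" for S
    using that by (intro Bochner_Integration.integral_nonneg prod_nonneg abs_exp_mixture_nonneg[OF f]) auto
  moreover have "I \<subseteq> {1..d}" "J \<subseteq> {1..d}" using IJ by auto
  ultimately show ?thesis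
    using trace_wishart_pos_assoc[OF assms] eq
    by (simp add: pos_assoc_def IJ ennreal_le_iff flip: ennreal_mult)
qed

end

section \<open>Negative powers and the value infinity\<close>

lemma tendsto_prod_ennreal:
  fixes f :: "'i \<Rightarrow> nat \<Rightarrow> ennreal"
  assumes "\<And>i. i \<in> I \<Longrightarrow> f i \<longlonglongrightarrow> l i" "\<And>i. i \<in> I \<Longrightarrow> l i \<noteq> 0"
  shows "(\<lambda>n. \<Prod>i\<in>I. f i n) \<longlonglongrightarrow> (\<Prod>i\<in>I. l i)"
  using assms
proof (induction I rule: infinite_finite_induct)
  case (insert i I)
  \<comment> \<open>Multiplication on \<open>[0, \<infinity>]\<close> is discontinuous at
    \<open>0 * \<infinity>\<close>; nonzero limits keep that case out.\<close>
  then show ?case by (simp, intro tendsto_mult_ennreal) auto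
qed auto

text \<open>The limit produces the conventions at 0 by itself: \<open>(1 / (n + 1)) powr q\<close>
  diverges for \<open>q < 0\<close> and is constantly 1 for \<open>q = 0\<close>, because the
  shifted base is positive.\<close>

lemma shifted_powr_tendsto_epow:
  assumes "q \<le> 0"
  shows "(\<lambda>n. ennreal ((\<bar>x\<bar> + 1 / real (Suc n)) powr q)) \<longlonglongrightarrow> epow \<bar>x\<bar> q"
proof -
  have lim: "(\<lambda>n. \<bar>x\<bar> + 1 / real (Suc n)) \<longlonglongrightarrow> \<bar>x\<bar> + 0"
    by (intro tendsto_intros LIMSEQ_Suc[OF lim_1_over_n])
  show ?thesis
  proof (cases "x = 0 \<and> q < 0")
    case True
    have "filterlim (\<lambda>n. real (Suc n) powr (- q)) at_top sequentially"
      using True by real_asymp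
    then have "filterlim (\<lambda>n. (1 / real (Suc n)) powr q) at_top sequentially"
      by (simp add: powr_minus_divide powr_divide del: of_nat_Suc)
    then show ?thesis
      using True by (simp add: epow_def ennreal_tendsto_top_eq_at_top)
  next
    case False
    show ?thesis
    proof (cases "x = 0")
      case True
      then show ?thesis using False assms by (simp add: epow_def rpow_def)
    next
      case x: False
      then have "(\<lambda>n. (\<bar>x\<bar> + 1 / real (Suc n)) powr q) \<longlonglongrightarrow> (\<bar>x\<bar> + 0) powr q"
        by (intro tendsto_powr lim tendsto_const) auto
      then show ?thesis using x by (auto simp: epow_def rpow_def intro!: tendsto_ennrealI)
    qed
  qed
qed

lemma epow_nonzero: "q \<le> 0 \<Longrightarrow> epow \<bar>x\<bar> q \<noteq> 0"
  by (auto simp: epow_def rpow_def ennreal_eq_0_iff)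

text \<open>Nonpositive exponents make every product increase as the shift shrinks, so the
  expectations in \<open>[0, \<infinity>]\<close> converge monotonically, whether or not their
  limits are finite.\<close>

lemma (in prob_space) trace_wishart_epow:
  assumes tw: "trace_wishart M d p \<alpha> \<Sigma> X" "psd_mat (\<Sum>i = 1..d. p i) \<Sigma>" "\<alpha> \<ge> 0"
    and IJ: "I \<union> J = {1..d}" "I \<inter> J = {}"
    and q: "\<And>i. i \<in> {1..d} \<Longrightarrow> q i \<le> 0"
  shows "(\<integral>\<^sup>+ \<omega>. (\<Prod>i\<in>I. epow (X i \<omega>) (q i)) \<partial>M) * (\<integral>\<^sup>+ \<omega>. (\<Prod>i\<in>J. epow (X i \<omega>) (q i)) \<partial>M) \<le>
    (\<integral>\<^sup>+ \<omega>. (\<Prod>i\<in>{1..d}. epow (X i \<omega>) (q i)) \<partial>M)"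
proof -
  define F where "F S n = (\<integral>\<^sup>+ \<omega>. (\<Prod>i\<in>S. ennreal ((\<bar>X i \<omega>\<bar> + 1 / real (Suc n)) powr q i)) \<partial>M)" for S n
  define G where "G S = (\<integral>\<^sup>+ \<omega>. (\<Prod>i\<in>S. epow (X i \<omega>) (q i)) \<partial>M)" for S
  have F: "F S \<longlonglongrightarrow> G S" "incseq (F S)" if S: "S \<subseteq> {1..d}" for S
  proof -
    have [measurable]: "X i \<in> borel_measurable M" if "i \<in> S" for i
      using tw(1) that S by (auto simp: trace_wishart_def)
    have inc: "incseq (\<lambda>n \<omega>. \<Prod>i\<in>S. ennreal ((\<bar>X i \<omega>\<bar> + 1 / real (Suc n)) powr q i))"
    proof (intro incseq_SucI le_funI prod_mono_ennreal ennreal_leI powr_mono2')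
      fix n \<omega> i assume "i \<in> S"
      then show "q i \<le> 0" using q S by auto
      show "0 < \<bar>X i \<omega>\<bar> + 1 / real (Suc (Suc n))" by (simp add: add_nonneg_pos)
      show "\<bar>X i \<omega>\<bar> + 1 / real (Suc (Suc n)) \<le> \<bar>X i \<omega>\<bar> + 1 / real (Suc n)"
        by (simp add: field_simps)
    qed
    have "F S \<longlonglongrightarrow> (\<integral>\<^sup>+ \<omega>. (\<Prod>i\<in>S. epow \<bar>X i \<omega>\<bar> (q i)) \<partial>M)"
      unfolding F_def
      by (rule nn_integral_LIMSEQ[OF inc])
        (use q S in \<open>auto intro!: tendsto_prod_ennreal shifted_powr_tendsto_epow epow_nonzero simp del: of_nat_Suc\<close>)
    also have "(\<integral>\<^sup>+ \<omega>. (\<Prod>i\<in>S. epow \<bar>X i \<omega>\<bar> (q i)) \<partial>M) = G S"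
      unfolding G_def
      by (rule nn_integral_cong_AE, rule AE_mp[OF trace_wishart_AE_nonneg[OF tw]])
        (use S in \<open>auto intro!: AE_I2 prod.cong\<close>)
    finally show "F S \<longlonglongrightarrow> G S" .
    show "incseq (F S)"
      unfolding F_def using inc by (auto simp: incseq_def le_fun_def intro!: nn_integral_mono)
  qed
  have sub: "I \<subseteq> {1..d}" "J \<subseteq> {1..d}" using IJ by auto
  have G: "G S = (SUP n. F S n)" if "S \<subseteq> {1..d}" for S
    using F[OF that] LIMSEQ_SUP LIMSEQ_unique by blast
  \<comment> \<open>The two suprema on the left run over independent indices; by monotonicity both
    are compared at the common index \<open>max m n\<close>.\<close>
  have "F I m * F J n \<le> G {1..d}" for m n
  proof -
    let ?k = "max m n"
    have "F I m * F J n \<le> F I ?k * F J ?k"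
      using F(2)[OF sub(1)] F(2)[OF sub(2)] by (intro mult_mono) (auto simp: incseq_def)
    also have "\<dots> \<le> F {1..d} ?k"
      using trace_wishart_nn_integral_prod_le[OF tw IJ, of "\<lambda>i x. (\<bar>x\<bar> + 1 / real (Suc ?k)) powr q i"] q
      unfolding F_def by (simp add: abs_exp_mixture_powr prod_ennreal del: of_nat_Suc)
    also have "\<dots> \<le> G {1..d}" unfolding G[OF order.refl] by (rule SUP_upper) simp
    finally show ?thesis .
  qed
  then have "G I * G J \<le> G {1..d}"
    unfolding G[OF sub(1)] G[OF sub(2)]
    by (simp add: SUP_mult_right_ennreal SUP_mult_left_ennreal SUP_least)
  then show ?thesis by (simp add: G_def)
qed

lemma (in prob_space) trace_wishart_exp_rpow:
  assumes tw: "trace_wishart M d p \<alpha> \<Sigma> X" "psd_mat (\<Sum>i = 1..d. p i) \<Sigma>" "\<alpha> \<ge> 0"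
    and IJ: "I \<union> J = {1..d}" "I \<inter> J = {}"
    and r: "\<And>i. i \<in> {1..d} \<Longrightarrow> 0 \<le> r i \<and> r i \<le> 1"
  shows "(\<integral>\<^sup>+ \<omega>. ennreal (\<Prod>i\<in>I. exp (- rpow (X i \<omega>) (r i))) \<partial>M) *
      (\<integral>\<^sup>+ \<omega>. ennreal (\<Prod>i\<in>J. exp (- rpow (X i \<omega>) (r i))) \<partial>M) \<le>
    (\<integral>\<^sup>+ \<omega>. ennreal (\<Prod>i\<in>{1..d}. exp (- rpow (X i \<omega>) (r i))) \<partial>M)"
proof -
  have eq: "(\<integral>\<^sup>+ \<omega>. ennreal (\<Prod>i\<in>S. exp (- rpow (X i \<omega>) (r i))) \<partial>M) =
     (\<integral>\<^sup>+ \<omega>. ennreal (\<Prod>i\<in>S. exp (- rpow \<bar>X i \<omega>\<bar> (r i))) \<partial>M)" if "S \<subseteq> {1..d}" for S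
    by (rule nn_integral_cong_AE, rule AE_mp[OF trace_wishart_AE_nonneg[OF tw]])
      (use that in \<open>auto intro!: AE_I2 arg_cong[where f = ennreal] prod.cong\<close>)
  have sub: "I \<subseteq> {1..d}" "J \<subseteq> {1..d}" using IJ by auto
  show ?thesis
    unfolding eq[OF sub(1)] eq[OF sub(2)] eq[OF order.refl]
    by (rule trace_wishart_nn_integral_prod_le[OF tw IJ]) (use r abs_exp_mixture_exp_rpow in auto)
qed

subsection \<open>Matrix exponentials of Kronecker sums\<close>

lemma mult_mat_entry:
  assumes "A \<in> carrier_mat n m" "B \<in> carrier_mat m l" "i < n" "j < l"
  shows "(A * B) $$ (i, j) = (\<Sum>k<m. A $$ (i, k) * B $$ (k, j))"
  using assms by (simp add: scalar_prod_def lessThan_atLeast0)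

text \<open>An entry of \<open>A ^\<^sub>m Suc k\<close> is a sum of \<open>n\<close> products with
  entries of \<open>A\<close>, so each power costs a factor \<open>n * c\<close>. The factorials in
  the exponential series outgrow this.\<close>

lemma pow_mat_entry_bound:
  fixes A :: "real mat"
  assumes A: "A \<in> carrier_mat n n" and c: "\<And>i j. i < n \<Longrightarrow> j < n \<Longrightarrow> \<bar>A $$ (i, j)\<bar> \<le> c"
    and ij: "i < n" "j < n"
  shows "\<bar>(A ^\<^sub>m k) $$ (i, j)\<bar> \<le> (real n * c) ^ k"
  using ij
proof (induction k arbitrary: i j)
  case 0
  then show ?case using A by simp
next
  case (Suc k)
  have "\<bar>(A ^\<^sub>m Suc k) $$ (i, j)\<bar> = \<bar>\<Sum>l<n. (A ^\<^sub>m k) $$ (i, l) * A $$ (l, j)\<bar>"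
    using mult_mat_entry[OF pow_carrier_mat[OF A] A Suc.prems] by simp
  also have "\<dots> \<le> (\<Sum>l<n. (real n * c) ^ k * c)"
    using Suc.IH[OF Suc.prems(1)] c[OF _ Suc.prems(2)]
    by (intro order.trans[OF sum_abs] sum_mono) (auto simp: abs_mult intro!: mult_mono order.trans[OF abs_ge_zero])
  finally show ?case by (simp add: mult_ac)
qed

lemma summable_mat_exp:
  fixes A :: "real mat"
  assumes A: "A \<in> carrier_mat n n" and ij: "i < n" "j < n"
  shows "summable (\<lambda>k. norm ((A ^\<^sub>m k) $$ (i, j) / fact k))"
proof -
  define c where "c = (\<Sum>i<n. \<Sum>j<n. \<bar>A $$ (i, j)\<bar>)"
  have "\<bar>A $$ (i, j)\<bar> \<le> c" if "i < n" "j < n" for i j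
  proof -
    have "\<bar>A $$ (i, j)\<bar> \<le> (\<Sum>j<n. \<bar>A $$ (i, j)\<bar>)"
      by (rule member_le_sum) (use that in auto)
    also have "\<dots> \<le> c"
      unfolding c_def by (rule member_le_sum) (use that in \<open>auto intro: sum_nonneg\<close>)
    finally show ?thesis .
  qed
  note bound = pow_mat_entry_bound[OF A this ij]
  show ?thesis
  proof (rule summable_comparison_test')
    show "summable (\<lambda>k. (real n * c) ^ k / fact k)"
      using summable_exp[of "real n * c"] by (simp add: divide_inverse mult.commute)
    show "norm (norm ((A ^\<^sub>m k) $$ (i, j) / fact k)) \<le> (real n * c) ^ k / fact k" for k
      using bound[of k] by (simp add: divide_right_mono)
  qed
qed

lemma mat_exp_carrier: "A \<in> carrier_mat n n \<Longrightarrow> mat_exp A \<in> carrier_mat n n"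
  by (simp add: mat_exp_def)

lemma mat_exp_entry:
  "A \<in> carrier_mat n n \<Longrightarrow> i < n \<Longrightarrow> j < n \<Longrightarrow>
    mat_exp A $$ (i, j) = (\<Sum>k. (A ^\<^sub>m k) $$ (i, j) / fact k)"
  by (simp add: mat_exp_def)

lemma smult_pow_mat_entry:
  fixes A :: "real mat"
  assumes A: "A \<in> carrier_mat n n" and ij: "i < n" "j < n"
  shows "((c \<cdot>\<^sub>m A) ^\<^sub>m k) $$ (i, j) = c ^ k * (A ^\<^sub>m k) $$ (i, j)"
  using ij
proof (induction k arbitrary: i j)
  case 0
  then show ?case using A by simp
next
  case (Suc k)
  have cA: "c \<cdot>\<^sub>m A \<in> carrier_mat n n" using A by simp
  have "((c \<cdot>\<^sub>m A) ^\<^sub>m Suc k) $$ (i, j) = (\<Sum>l<n. (c ^ k * (A ^\<^sub>m k) $$ (i, l)) * (c * A $$ (l, j)))"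
    using mult_mat_entry[OF pow_carrier_mat[OF cA] cA Suc.prems] A Suc
    by (simp cong: sum.cong_simp)
  also have "\<dots> = c ^ Suc k * (\<Sum>l<n. (A ^\<^sub>m k) $$ (i, l) * A $$ (l, j))"
    by (simp add: sum_distrib_left mult_ac)
  finally show ?case
    using mult_mat_entry[OF pow_carrier_mat[OF A] A Suc.prems] by simp
qed

lemma pow_mat_add:
  fixes A :: "'a :: semiring_1 mat"
  assumes A: "A \<in> carrier_mat n n"
  shows "A ^\<^sub>m (r + s) = A ^\<^sub>m r * A ^\<^sub>m s"
proof (induction s)
  case 0
  then show ?case using A pow_carrier_mat[OF A, of r] by simp
next
  case (Suc s)
  then show ?case
    using assoc_mult_mat[OF pow_carrier_mat[OF A, of r] pow_carrier_mat[OF A, of s] A] by simp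
qed

lemma pow_mat_symmetric:
  fixes A :: "real mat"
  assumes A: "A \<in> carrier_mat n n" "transpose_mat A = A"
  shows "transpose_mat (A ^\<^sub>m k) = A ^\<^sub>m k"
proof (induction k)
  case (Suc k)
  have "transpose_mat (A ^\<^sub>m Suc k) = A * A ^\<^sub>m k"
    using transpose_mult[OF pow_carrier_mat[OF A(1), of k] A(1)] Suc A by simp
  also have "\<dots> = A ^\<^sub>m (1 + k)"
    using pow_mat_add[OF A(1), of 1 k] A by simp
  finally show ?case by simp
qed simp

lemma transpose_smult: "transpose_mat (c \<cdot>\<^sub>m A) = c \<cdot>\<^sub>m transpose_mat A"
  by (rule eq_matI) auto

text \<open>The exponential of \<open>A\<close> is the square of the exponential of
  \<open>B\<close>, half of \<open>A\<close>. The latter is symmetric, so a diagonal entry of the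
  square is a sum of squares. Nonnegativity lets the trace bound each diagonal entry, which later
  gives integrability.\<close>

lemma mat_exp_diag_nonneg:
  fixes A :: "real mat"
  assumes A: "A \<in> carrier_mat n n" "transpose_mat A = A" and i: "i < n"
  shows "mat_exp A $$ (i, i) \<ge> 0"
proof -
  define B where "B = (1 / 2) \<cdot>\<^sub>m A"
  have B: "B \<in> carrier_mat n n" "transpose_mat B = B"
    using A by (simp_all add: B_def transpose_smult)
  have AB: "A = 2 \<cdot>\<^sub>m B" using A by (auto simp: B_def)
  let ?a = "\<lambda>l k. (B ^\<^sub>m k) $$ (i, l) / fact k" and ?b = "\<lambda>l k. (B ^\<^sub>m k) $$ (l, i) / fact k"
  have sym: "?b l k = ?a l k" if "l < n" for l k
    using pow_mat_symmetric[OF B, of k] pow_carrier_mat[OF B(1), of k] that i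
    by (metis carrier_matD index_transpose_mat(1))
  have "(\<lambda>k. \<Sum>l<n. \<Sum>r\<le>k. ?a l r * ?b l (k - r)) sums (\<Sum>l<n. (\<Sum>k. ?a l k) * (\<Sum>k. ?b l k))"
    by (intro sums_sum Cauchy_product_sums summable_mat_exp[OF B(1)]) (use i in auto)
  also have "(\<lambda>k. \<Sum>l<n. \<Sum>r\<le>k. ?a l r * ?b l (k - r)) = (\<lambda>k. (A ^\<^sub>m k) $$ (i, i) / fact k)"
  proof
    fix k
    have "(\<Sum>l<n. \<Sum>r\<le>k. ?a l r * ?b l (k - r)) =
        (\<Sum>r\<le>k. (\<Sum>l<n. (B ^\<^sub>m r) $$ (i, l) * (B ^\<^sub>m (k - r)) $$ (l, i)) / (fact r * fact (k - r)))"
      by (subst sum.swap) (simp add: sum_divide_distrib)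
    also have "\<dots> = (\<Sum>r\<le>k. (B ^\<^sub>m k) $$ (i, i) / (fact r * fact (k - r)))"
    proof (intro sum.cong refl)
      fix r assume "r \<in> {..k}"
      then have "B ^\<^sub>m k = B ^\<^sub>m r * B ^\<^sub>m (k - r)"
        using pow_mat_add[OF B(1), of r "k - r"] by simp
      then show "(\<Sum>l<n. (B ^\<^sub>m r) $$ (i, l) * (B ^\<^sub>m (k - r)) $$ (l, i)) / (fact r * fact (k - r)) =
          (B ^\<^sub>m k) $$ (i, i) / (fact r * fact (k - r))"
        using mult_mat_entry[OF pow_carrier_mat[OF B(1)] pow_carrier_mat[OF B(1)] i i] by simp
    qed
    \<comment> \<open>The binomial row sum \<open>2 ^ k\<close> is exactly the factor between
      \<open>A ^\<^sub>m k\<close> and \<open>B ^\<^sub>m k\<close>.\<close>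
    also have "\<dots> = (B ^\<^sub>m k) $$ (i, i) * (\<Sum>r\<le>k. real (k choose r)) / fact k"
      by (simp add: sum_distrib_left sum_divide_distrib binomial_fact)
    also have "(\<Sum>r\<le>k. real (k choose r)) = 2 ^ k"
      using choose_row_sum[of k] by (simp flip: of_nat_sum)
    finally show "(\<Sum>l<n. \<Sum>r\<le>k. ?a l r * ?b l (k - r)) = (A ^\<^sub>m k) $$ (i, i) / fact k"
      unfolding AB smult_pow_mat_entry[OF B(1) i i] by (simp add: mult.commute)
  qed
  finally have "mat_exp A $$ (i, i) = (\<Sum>l<n. (\<Sum>k. ?a l k) * (\<Sum>k. ?b l k))"
    using mat_exp_entry[OF A(1) i i] by (simp add: sums_iff)
  also have "\<dots> = (\<Sum>l<n. (\<Sum>k. ?a l k) * (\<Sum>k. ?a l k))"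
    by (intro sum.cong refl) (simp add: sym)
  also have "\<dots> \<ge> 0" by (intro sum_nonneg) simp
  finally show ?thesis .
qed

section \<open>Kronecker products, Kronecker sums and their exponentials\<close>

lemma kron_prod_carrier:
  "A \<in> carrier_mat n n \<Longrightarrow> B \<in> carrier_mat m m \<Longrightarrow> kron_prod A B \<in> carrier_mat (n * m) (n * m)"
  by (simp add: kron_prod_def)

lemma kron_prod_entry:
  "A \<in> carrier_mat n n \<Longrightarrow> B \<in> carrier_mat m m \<Longrightarrow> i < n * m \<Longrightarrow> j < n * m \<Longrightarrow>
    kron_prod A B $$ (i, j) = A $$ (i div m, j div m) * B $$ (i mod m, j mod m)"
  by (auto simp: kron_prod_def)

lemma kron_sum_carrier:
  "A \<in> carrier_mat n n \<Longrightarrow> B \<in> carrier_mat m m \<Longrightarrow> kron_sum A B \<in> carrier_mat (n * m) (n * m)"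
  by (simp add: kron_sum_def kron_prod_def)

lemma div_mod_less_mult:
  fixes i :: nat
  assumes "i < n * m"
  shows "i div m < n" "i mod m < m"
proof -
  have "m > 0" using assms by (cases m) auto
  then show "i div m < n" "i mod m < m"
    using assms by (simp_all add: less_mult_imp_div_less)
qed

lemma kron_sum_entry:
  assumes "A \<in> carrier_mat n n" "B \<in> carrier_mat m m" "i < n * m" "j < n * m"
  shows "kron_sum A B $$ (i, j) =
    (if i mod m = j mod m then A $$ (i div m, j div m) else 0) +
    (if i div m = j div m then B $$ (i mod m, j mod m) else 0)"
proof -
  have "kron_sum A B $$ (i, j) = kron_prod A (1\<^sub>m m) $$ (i, j) + kron_prod (1\<^sub>m n) B $$ (i, j)"
    using assms kron_prod_carrier[of "1\<^sub>m n" n B m] by (simp add: kron_sum_def)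
  then show ?thesis
    using kron_prod_entry[OF assms(1) one_carrier_mat assms(3,4)]
      kron_prod_entry[OF one_carrier_mat assms(2-4)] div_mod_less_mult[OF assms(3)]
      div_mod_less_mult[OF assms(4)] by simp
qed

lemma sum_div_mod:
  fixes g :: "nat \<Rightarrow> nat \<Rightarrow> 'a :: comm_monoid_add"
  shows "(\<Sum>i<n * m. g (i div m) (i mod m)) = (\<Sum>a<n. \<Sum>b<m. g a b)"
proof -
  have "(\<Sum>i<n * m. g (i div m) (i mod m)) = (\<Sum>(a, b)\<in>{..<n} \<times> {..<m}. g a b)"
  proof (rule sum.reindex_bij_witness[where i = "\<lambda>(a, b). a * m + b" and j = "\<lambda>i. (i div m, i mod m)"])
    fix ab assume "ab \<in> {..<n} \<times> {..<m}"
    then obtain a b where ab: "ab = (a, b)" "a < n" "b < m" by auto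
    have "a * m + b < Suc a * m" using ab by simp
    also have "\<dots> \<le> n * m" using ab by (intro mult_le_mono1) simp
    finally show "(case ab of (a, b) \<Rightarrow> a * m + b) \<in> {..<n * m}" using ab by simp
    show "((case ab of (a, b) \<Rightarrow> a * m + b) div m, (case ab of (a, b) \<Rightarrow> a * m + b) mod m) = ab"
      using ab by simp
  qed (use div_mod_less_mult in auto)
  then show ?thesis by (simp add: sum.cartesian_product)
qed

lemma mat_trace_kron_prod:
  assumes "A \<in> carrier_mat n n" "B \<in> carrier_mat m m"
  shows "mat_trace (kron_prod A B) = mat_trace A * mat_trace B"
proof -
  have "mat_trace (kron_prod A B) = (\<Sum>i<n * m. A $$ (i div m, i div m) * B $$ (i mod m, i mod m))"
    using kron_prod_carrier[OF assms] by (simp add: mat_trace_def kron_prod_entry[OF assms])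
  also have "\<dots> = (\<Sum>a<n. \<Sum>b<m. A $$ (a, a) * B $$ (b, b))"
    by (rule sum_div_mod[where g = "\<lambda>a b. A $$ (a, a) * B $$ (b, b)"])
  finally show ?thesis using assms by (simp add: mat_trace_def sum_product)
qed

text \<open>The induction step for binomial convolutions: Pascal's rule splits each coefficient, and
  the surplus term \<open>r = Suc k\<close> vanishes because
  \<open>k choose Suc k = 0\<close>.\<close>

lemma convolution_Pascal:
  fixes u v :: "nat \<Rightarrow> real"
  shows "(\<Sum>r\<le>k. real (k choose r) * u (Suc r) * v (k - r)) + (\<Sum>r\<le>k. real (k choose r) * u r * v (Suc k - r)) =
    (\<Sum>r\<le>Suc k. real (Suc k choose r) * u r * v (Suc k - r))"
proof -
  have "(\<Sum>r\<le>Suc k. real (Suc k choose r) * u r * v (Suc k - r)) =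
      u 0 * v (Suc k) + (\<Sum>r\<le>k. real (Suc k choose Suc r) * u (Suc r) * v (k - r))"
    by (subst sum.atMost_Suc_shift) simp
  also have "(\<Sum>r\<le>k. real (Suc k choose Suc r) * u (Suc r) * v (k - r)) =
      (\<Sum>r\<le>k. real (k choose r) * u (Suc r) * v (k - r)) + (\<Sum>r\<le>k. real (k choose Suc r) * u (Suc r) * v (k - r))"
    by (simp add: distrib_right sum.distrib)
  also have "u 0 * v (Suc k) + (\<dots>) = (\<Sum>r\<le>k. real (k choose r) * u (Suc r) * v (k - r)) +
      (\<Sum>r\<le>Suc k. real (k choose r) * u r * v (Suc k - r))"
  proof -
    have "(\<Sum>r\<le>Suc k. real (k choose r) * u r * v (Suc k - r)) =
        u 0 * v (Suc k) + (\<Sum>r\<le>k. real (k choose Suc r) * u (Suc r) * v (k - r))"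
      by (subst sum.atMost_Suc_shift) simp
    then show ?thesis by simp
  qed
  finally show ?thesis by (simp add: binomial_eq_0)
qed

text \<open>The binomial theorem for the two commuting summands of the Kronecker sum, read off
  entrywise. One more factor either raises the power of \<open>A\<close>, fixing the inner index, or
  that of \<open>B\<close>, fixing the outer index.\<close>

lemma kron_sum_pow_entry:
  assumes A: "A \<in> carrier_mat n n" and B: "B \<in> carrier_mat m m" and ij: "i < n * m" "j < n * m"
  shows "(kron_sum A B ^\<^sub>m k) $$ (i, j) =
    (\<Sum>r\<le>k. real (k choose r) * (A ^\<^sub>m r) $$ (i div m, j div m) * (B ^\<^sub>m (k - r)) $$ (i mod m, j mod m))"
  using ij
proof (induction k arbitrary: j)
  case 0
  have "i = j \<longleftrightarrow> i div m = j div m \<and> i mod m = j mod m"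
    by (metis div_mult_mod_eq)
  then show ?case
    using A B 0 div_mod_less_mult[OF 0(1)] div_mod_less_mult[OF 0(2)] kron_sum_carrier[OF A B]
    by simp
next
  case (Suc k)
  let ?K = "kron_sum A B"
  define P where "P a b = (\<Sum>r\<le>k. real (k choose r) * (A ^\<^sub>m r) $$ (i div m, a) * (B ^\<^sub>m (k - r)) $$ (i mod m, b))" for a b
  have K: "?K \<in> carrier_mat (n * m) (n * m)" by (rule kron_sum_carrier[OF A B])
  note i = div_mod_less_mult[OF Suc.prems(1)] and j = div_mod_less_mult[OF Suc.prems(2)]
  have "(?K ^\<^sub>m Suc k) $$ (i, j) = (\<Sum>l<n * m. (?K ^\<^sub>m k) $$ (i, l) * ?K $$ (l, j))"
    using mult_mat_entry[OF pow_carrier_mat[OF K] K Suc.prems] by simp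
  also have "\<dots> = (\<Sum>l<n * m. P (l div m) (l mod m) *
      ((if l mod m = j mod m then A $$ (l div m, j div m) else 0) +
       (if l div m = j div m then B $$ (l mod m, j mod m) else 0)))"
    by (intro sum.cong refl) (use Suc in \<open>simp add: kron_sum_entry[OF A B] P_def\<close>)
  also have "\<dots> = (\<Sum>a<n. \<Sum>b<m. P a b *
      ((if b = j mod m then A $$ (a, j div m) else 0) + (if a = j div m then B $$ (b, j mod m) else 0)))"
    by (rule sum_div_mod[where g = "\<lambda>a b. P a b *
      ((if b = j mod m then A $$ (a, j div m) else 0) + (if a = j div m then B $$ (b, j mod m) else 0))"])
  also have "\<dots> = (\<Sum>a<n. \<Sum>b<m. if b = j mod m then P a b * A $$ (a, j div m) else 0) +
     (\<Sum>b<m. \<Sum>a<n. if a = j div m then P a b * B $$ (b, j mod m) else 0)"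
  proof -
    have "P a b * ((if b = j mod m then A $$ (a, j div m) else 0) + (if a = j div m then B $$ (b, j mod m) else 0)) =
        (if b = j mod m then P a b * A $$ (a, j div m) else 0) + (if a = j div m then P a b * B $$ (b, j mod m) else 0)" for a b
      by (simp add: distrib_left)
    then have "(\<Sum>a<n. \<Sum>b<m. P a b *
        ((if b = j mod m then A $$ (a, j div m) else 0) + (if a = j div m then B $$ (b, j mod m) else 0))) =
        (\<Sum>a<n. \<Sum>b<m. if b = j mod m then P a b * A $$ (a, j div m) else 0) +
        (\<Sum>a<n. \<Sum>b<m. if a = j div m then P a b * B $$ (b, j mod m) else 0)"
      by (simp only: sum.distrib)
    also have "(\<Sum>a<n. \<Sum>b<m. if a = j div m then P a b * B $$ (b, j mod m) else 0) =
        (\<Sum>b<m. \<Sum>a<n. if a = j div m then P a b * B $$ (b, j mod m) else 0)"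
      by (rule sum.swap)
    finally show ?thesis .
  qed
  also have "\<dots> = (\<Sum>a<n. P a (j mod m) * A $$ (a, j div m)) + (\<Sum>b<m. P (j div m) b * B $$ (b, j mod m))"
    using j by (simp add: sum.delta)
  also have "(\<Sum>a<n. P a (j mod m) * A $$ (a, j div m)) = (\<Sum>r\<le>k. real (k choose r) *
      (A ^\<^sub>m Suc r) $$ (i div m, j div m) * (B ^\<^sub>m (k - r)) $$ (i mod m, j mod m))"
    unfolding P_def sum_distrib_right pow_mat.simps mult_mat_entry[OF pow_carrier_mat[OF A] A i(1) j(1)]
    by (subst sum.swap) (simp add: sum_distrib_left sum_distrib_right mult_ac)
  also have "(\<Sum>b<m. P (j div m) b * B $$ (b, j mod m)) = (\<Sum>r\<le>k. real (k choose r) *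
      (A ^\<^sub>m r) $$ (i div m, j div m) * (B ^\<^sub>m Suc (k - r)) $$ (i mod m, j mod m))"
    unfolding P_def sum_distrib_right pow_mat.simps mult_mat_entry[OF pow_carrier_mat[OF B] B i(2) j(2)]
    by (subst sum.swap) (simp add: sum_distrib_left sum_distrib_right mult_ac)
  also have "\<dots> = (\<Sum>r\<le>k. real (k choose r) *
      (A ^\<^sub>m r) $$ (i div m, j div m) * (B ^\<^sub>m (Suc k - r)) $$ (i mod m, j mod m))"
    by (intro sum.cong refl) (simp add: Suc_diff_le)
  also note convolution_Pascal[where u = "\<lambda>r. (A ^\<^sub>m r) $$ (i div m, j div m)" and v = "\<lambda>r. (B ^\<^sub>m r) $$ (i mod m, j mod m)"]
  finally show ?case .
qed

text \<open>Division by \<open>fact k\<close> turns the binomial coefficients into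
  \<open>1 / (fact r * fact (k - r))\<close>, so the series for the Kronecker sum is the Cauchy
  product of two absolutely convergent series.\<close>

lemma mat_exp_kron_sum:
  assumes A: "A \<in> carrier_mat n n" and B: "B \<in> carrier_mat m m"
  shows "mat_exp (kron_sum A B) = kron_prod (mat_exp A) (mat_exp B)"
proof (rule eq_matI)
  note carrier = kron_sum_carrier[OF A B] kron_prod_carrier[OF mat_exp_carrier[OF A] mat_exp_carrier[OF B]]
  show "dim_row (mat_exp (kron_sum A B)) = dim_row (kron_prod (mat_exp A) (mat_exp B))"
    "dim_col (mat_exp (kron_sum A B)) = dim_col (kron_prod (mat_exp A) (mat_exp B))"
    using carrier_matD[OF mat_exp_carrier[OF carrier(1)]] carrier_matD[OF carrier(2)] by simp_all
  fix i j assume "i < dim_row (kron_prod (mat_exp A) (mat_exp B))" "j < dim_col (kron_prod (mat_exp A) (mat_exp B))"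
  then have ij: "i < n * m" "j < n * m" using carrier by auto
  note i = div_mod_less_mult[OF ij(1)] and j = div_mod_less_mult[OF ij(2)]
  let ?a = "\<lambda>k. (A ^\<^sub>m k) $$ (i div m, j div m) / fact k"
  let ?b = "\<lambda>k. (B ^\<^sub>m k) $$ (i mod m, j mod m) / fact k"
  have "mat_exp (kron_sum A B) $$ (i, j) = (\<Sum>k. (kron_sum A B ^\<^sub>m k) $$ (i, j) / fact k)"
    by (rule mat_exp_entry[OF carrier(1) ij])
  also have "\<dots> = (\<Sum>k. \<Sum>r\<le>k. ?a r * ?b (k - r))"
    unfolding kron_sum_pow_entry[OF A B ij] sum_divide_distrib
    by (intro suminf_cong sum.cong refl) (simp add: binomial_fact)
  also have "\<dots> = (\<Sum>k. ?a k) * (\<Sum>k. ?b k)"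
    by (rule Cauchy_product[OF summable_mat_exp[OF A i(1) j(1)] summable_mat_exp[OF B i(2) j(2)], symmetric])
  also have "\<dots> = kron_prod (mat_exp A) (mat_exp B) $$ (i, j)"
    unfolding kron_prod_entry[OF mat_exp_carrier[OF A] mat_exp_carrier[OF B] ij]
      mat_exp_entry[OF A i(1) j(1)] mat_exp_entry[OF B i(2) j(2)] by (rule refl)
  finally show "mat_exp (kron_sum A B) $$ (i, j) = kron_prod (mat_exp A) (mat_exp B) $$ (i, j)" .
qed

lemma uminus_kron_sum:
  assumes A: "A \<in> carrier_mat n n" and B: "B \<in> carrier_mat m m"
  shows "- kron_sum A B = kron_sum (- A) (- B)"
proof (rule eq_matI)
  have A': "- A \<in> carrier_mat n n" and B': "- B \<in> carrier_mat m m"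
    by (rule uminus_carrier_mat[OF A]) (rule uminus_carrier_mat[OF B])
  note K = carrier_matD[OF kron_sum_carrier[OF A B]]
  note K' = carrier_matD[OF kron_sum_carrier[OF A' B']]
  show "dim_row (- kron_sum A B) = dim_row (kron_sum (- A) (- B))"
    "dim_col (- kron_sum A B) = dim_col (kron_sum (- A) (- B))"
    unfolding index_uminus_mat K K' by (rule refl)+
  fix i j assume "i < dim_row (kron_sum (- A) (- B))" "j < dim_col (kron_sum (- A) (- B))"
  then have ij: "i < n * m" "j < n * m" unfolding K' .
  have "(- kron_sum A B) $$ (i, j) = - (kron_sum A B $$ (i, j))"
    by (rule index_uminus_mat(1)) (use ij K in simp_all)
  moreover have "(- A) $$ (i div m, j div m) = - A $$ (i div m, j div m)"
    by (rule index_uminus_mat(1)) (unfold carrier_matD[OF A], rule div_mod_less_mult[OF ij(1)], rule div_mod_less_mult[OF ij(2)])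
  moreover have "(- B) $$ (i mod m, j mod m) = - B $$ (i mod m, j mod m)"
    by (rule index_uminus_mat(1)) (unfold carrier_matD[OF B], rule div_mod_less_mult[OF ij(1)], rule div_mod_less_mult[OF ij(2)])
  ultimately show "(- kron_sum A B) $$ (i, j) = kron_sum (- A) (- B) $$ (i, j)"
    unfolding kron_sum_entry[OF A B ij] kron_sum_entry[OF A' B' ij] by simp
qed

lemma kron_sum_list_carrier:
  "(\<And>A. A \<in> set As \<Longrightarrow> A \<in> carrier_mat n n) \<Longrightarrow>
    kron_sum_list As \<in> carrier_mat (n ^ length As) (n ^ length As)"
proof (induction As rule: kron_sum_list.induct)
  case (3 A B As)
  have "A \<in> carrier_mat n n" using "3.prems" by simp
  moreover have "kron_sum_list (B # As) \<in> carrier_mat (n ^ length (B # As)) (n ^ length (B # As))"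
    by (rule "3.IH") (rule "3.prems", simp)
  ultimately show ?case
    unfolding kron_sum_list.simps list.size(4)[of A] add_Suc_right add_0_right power_Suc[of n "length (B # As)"]
    by (rule kron_sum_carrier)
qed auto

lemma uminus_kron_sum_list:
  "(\<And>A. A \<in> set As \<Longrightarrow> A \<in> carrier_mat n n) \<Longrightarrow> - kron_sum_list As = kron_sum_list (map uminus As)"
proof (induction As rule: kron_sum_list.induct)
  case (3 A B As)
  have "- kron_sum A (kron_sum_list (B # As)) = kron_sum (- A) (- kron_sum_list (B # As))"
    by (rule uminus_kron_sum[of _ n]) (use 3 kron_sum_list_carrier[of "B # As" n] in auto)
  with 3 show ?case by simp
qed auto

lemma mat_exp_kron_sum_list_trace:
  assumes "As \<noteq> []" "\<And>A. A \<in> set As \<Longrightarrow> A \<in> carrier_mat n n"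
  shows "mat_trace (mat_exp (kron_sum_list As)) = prod_list (map (\<lambda>A. mat_trace (mat_exp A)) As)"
  using assms
proof (induction As rule: kron_sum_list.induct)
  case (3 A B As)
  have A: "A \<in> carrier_mat n n" using 3 by auto
  have BAs: "kron_sum_list (B # As) \<in> carrier_mat (n ^ length (B # As)) (n ^ length (B # As))"
    by (rule kron_sum_list_carrier) (use 3 in auto)
  show ?case
    using 3 by (simp add: mat_exp_kron_sum[OF A BAs] mat_trace_kron_prod[OF mat_exp_carrier[OF A] mat_exp_carrier[OF BAs]])
qed auto

text \<open>\<open>cs\<close> is the list of base-\<open>n\<close> digits of \<open>a\<close>,
  leading digit at the head. It depends on \<open>a\<close> and not on the matrices, hence the order
  of the quantifiers: for random matrices the same digits serve every outcome, and measurability and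
  bounds can be checked factor by factor.\<close>

lemma mat_exp_kron_sum_list_diag:
  assumes "a < n ^ Suc N"
  shows "\<exists>cs. length cs = Suc N \<and> (\<forall>c\<in>set cs. c < n) \<and>
    (\<forall>As. length As = Suc N \<longrightarrow> (\<forall>A\<in>set As. A \<in> carrier_mat n n) \<longrightarrow>
      mat_exp (kron_sum_list As) $$ (a, a) = (\<Prod>i<Suc N. mat_exp (As ! i) $$ (cs ! i, cs ! i)))"
  using assms
proof (induction N arbitrary: a)
  case 0
  then show ?case by (intro exI[of _ "[a]"]) (auto simp: length_Suc_conv)
next
  case (Suc N)
  let ?m = "n ^ Suc N"
  have a: "a < n * ?m" using Suc.prems by simp
  obtain cs where cs: "length cs = Suc N" "\<forall>c\<in>set cs. c < n"
    "\<And>As. length As = Suc N \<Longrightarrow> \<forall>A\<in>set As. A \<in> carrier_mat n n \<Longrightarrow>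
      mat_exp (kron_sum_list As) $$ (a mod ?m, a mod ?m) =
        (\<Prod>i<Suc N. mat_exp (As ! i) $$ (cs ! i, cs ! i))"
    using Suc.IH[OF div_mod_less_mult(2)[OF a]] by blast
  have ds: "\<forall>c\<in>set (a div ?m # cs). c < n"
    using div_mod_less_mult(1)[OF a] cs(2) by (metis set_ConsD)
  show ?case
  proof (intro exI[of _ "a div ?m # cs"] conjI allI impI ds)
    show "length (a div ?m # cs) = Suc (Suc N)" using cs(1) by simp
    fix As :: "real mat list"
    assume As: "length As = Suc (Suc N)" "\<forall>A\<in>set As. A \<in> carrier_mat n n"
    then obtain A B Bs where A: "As = A # B # Bs" by (auto simp: length_Suc_conv)
    have c: "A \<in> carrier_mat n n" "kron_sum_list (B # Bs) \<in> carrier_mat ?m ?m"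
    proof -
      show "A \<in> carrier_mat n n" using As(2) by (simp add: A)
      have "kron_sum_list (B # Bs) \<in> carrier_mat (n ^ length (B # Bs)) (n ^ length (B # Bs))"
        by (rule kron_sum_list_carrier) (use As(2) in \<open>auto simp: A\<close>)
      moreover have "length (B # Bs) = Suc N" using As(1) by (simp add: A)
      ultimately show "kron_sum_list (B # Bs) \<in> carrier_mat ?m ?m" by (simp only:)
    qed
    have "mat_exp (kron_sum_list As) $$ (a, a) =
        mat_exp A $$ (a div ?m, a div ?m) * mat_exp (kron_sum_list (B # Bs)) $$ (a mod ?m, a mod ?m)"
      unfolding A kron_sum_list.simps mat_exp_kron_sum[OF c]
      by (rule kron_prod_entry[OF mat_exp_carrier[OF c(1)] mat_exp_carrier[OF c(2)] a a])
    also have "mat_exp (kron_sum_list (B # Bs)) $$ (a mod ?m, a mod ?m) =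
        (\<Prod>i<Suc N. mat_exp ((B # Bs) ! i) $$ (cs ! i, cs ! i))"
      by (rule cs(3)) (use As in \<open>simp_all add: A\<close>)
    finally show "mat_exp (kron_sum_list As) $$ (a, a) =
        (\<Prod>i<Suc (Suc N). mat_exp (As ! i) $$ ((a div ?m # cs) ! i, (a div ?m # cs) ! i))"
      unfolding A by (simp add: prod.lessThan_Suc_shift del: prod.lessThan_Suc)
  qed
qed

subsection \<open>Traces of exponentials of positive semidefinite matrices\<close>

text \<open>Cyclicity of the trace, applied to \<open>P * (B ^\<^sub>m k * Q)\<close> with
  \<open>Q * P\<close> the identity.\<close>

lemma trace_pow_similar:
  fixes A B :: "'a :: comm_ring_1 mat"
  assumes A: "A \<in> carrier_mat n n" and sim: "similar_mat A B"
  shows "(\<Sum>i<n. (A ^\<^sub>m k) $$ (i, i)) = (\<Sum>i<n. (B ^\<^sub>m k) $$ (i, i))"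
proof -
  obtain P Q where wit: "similar_mat_wit A B P Q" using sim by (auto simp: similar_mat_def)
  note w = similar_mat_witD2[OF A wit]
  have Bk: "B ^\<^sub>m k \<in> carrier_mat n n" using w(5) by (rule pow_carrier_mat)
  define C where "C = B ^\<^sub>m k * Q"
  have C: "C \<in> carrier_mat n n" using Bk w(7) by (simp add: C_def)
  have "A ^\<^sub>m k = P * C"
    using similar_mat_wit_pow_id[OF wit, of k] assoc_mult_mat[OF w(6) Bk w(7)] by (simp add: C_def)
  then have "(\<Sum>i<n. (A ^\<^sub>m k) $$ (i, i)) = (\<Sum>i<n. \<Sum>l<n. P $$ (i, l) * C $$ (l, i))"
    by (simp add: mult_mat_entry[OF w(6) C])
  also have "\<dots> = (\<Sum>l<n. \<Sum>i<n. C $$ (l, i) * P $$ (i, l))"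
    by (subst sum.swap) (simp add: mult.commute)
  also have "\<dots> = (\<Sum>l<n. (C * P) $$ (l, l))"
    by (simp add: mult_mat_entry[OF C w(6)])
  also have "C * P = B ^\<^sub>m k"
    using assoc_mult_mat[OF Bk w(7) w(6)] w(2) right_mult_one_mat[OF Bk] by (simp add: C_def)
  finally show ?thesis .
qed

text \<open>Both claims are proved together: in the sum for a diagonal entry, the terms off the
  diagonal vanish because the lower power is itself upper triangular.\<close>

lemma upper_triangular_pow:
  fixes B :: "'a :: comm_ring_1 mat"
  assumes B: "B \<in> carrier_mat n n" and ut: "upper_triangular B"
  shows "(\<forall>i<n. \<forall>j<i. (B ^\<^sub>m k) $$ (i, j) = 0) \<and> (\<forall>i<n. (B ^\<^sub>m k) $$ (i, i) = (B $$ (i, i)) ^ k)"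
proof (induction k)
  case 0
  then show ?case using B by auto
next
  case (Suc k)
  note Bk = pow_carrier_mat[OF B, of k]
  have ut': "B $$ (i, j) = 0" if "i < n" "j < i" for i j
    using ut that B by (auto simp: upper_triangular_def)
  have "(B ^\<^sub>m Suc k) $$ (i, j) = 0" if "i < n" "j < i" for i j
  proof -
    have "(B ^\<^sub>m Suc k) $$ (i, j) = (\<Sum>l<n. (B ^\<^sub>m k) $$ (i, l) * B $$ (l, j))"
      using mult_mat_entry[OF Bk B] that by simp
    also have "\<dots> = 0"
    proof (rule sum.neutral, rule ballI)
      fix l assume "l \<in> {..<n}"
      then show "(B ^\<^sub>m k) $$ (i, l) * B $$ (l, j) = 0"
        using Suc ut' that by (cases "l < i") auto
    qed
    finally show ?thesis .
  qed
  moreover have "(B ^\<^sub>m Suc k) $$ (i, i) = (B $$ (i, i)) ^ Suc k" if "i < n" for i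
  proof -
    have "(B ^\<^sub>m Suc k) $$ (i, i) = (\<Sum>l<n. (B ^\<^sub>m k) $$ (i, l) * B $$ (l, i))"
      using mult_mat_entry[OF Bk B] that by simp
    also have "\<dots> = (\<Sum>l\<in>{i}. (B ^\<^sub>m k) $$ (i, l) * B $$ (l, i))"
    proof (rule sum.mono_neutral_right)
      show "\<forall>l\<in>{..<n} - {i}. (B ^\<^sub>m k) $$ (i, l) * B $$ (l, i) = 0"
      proof
        fix l assume "l \<in> {..<n} - {i}"
        then show "(B ^\<^sub>m k) $$ (i, l) * B $$ (l, i) = 0"
          using Suc ut' that by (cases "l < i") auto
      qed
    qed (use that in auto)
    finally show ?thesis using Suc that by (simp add: mult.commute)
  qed
  ultimately show ?case by blast
qed

text \<open>For an eigenvector \<open>z\<close>, the sum of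
  \<open>cnj (z i) * A $$ (i, j) * z j\<close> equals \<open>e\<close> times the squared norm
  \<open>S\<close>. Symmetry of \<open>A\<close> cancels its imaginary part, and its real part
  \<open>q\<close> is the sum of the forms at the real and imaginary parts of \<open>z\<close>;
  hence \<open>e = q / S\<close>.\<close>

lemma eigenvalue_complex_psd:
  assumes psd: "psd_mat n A" and ev: "eigenvalue (map_mat complex_of_real A) e"
  obtains l where "l \<ge> 0" "e = complex_of_real l"
proof -
  have A: "A \<in> carrier_mat n n" using psd by (simp add: psd_mat_def)
  have pf: "psd_fun n (\<lambda>i j. A $$ (i, j))" using psd_mat_quad_form[OF psd] .
  then have sym: "A $$ (i, j) = A $$ (j, i)" if "i < n" "j < n" for i j
    using that by (auto simp: psd_fun_def sym_fun_def)
  obtain v where v: "v \<in> carrier_vec n" "v \<noteq> 0\<^sub>v n" "map_mat complex_of_real A *\<^sub>v v = e \<cdot>\<^sub>v v"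
    using ev A by (auto simp: eigenvalue_def eigenvector_def)
  define z where "z = (\<lambda>i. vec_index v i)"
  define S where "S = (\<Sum>i<n. (cmod (z i))\<^sup>2)"
  define q where "q = quad_form n (\<lambda>i j. A $$ (i, j)) (\<lambda>i. Re (z i)) + quad_form n (\<lambda>i j. A $$ (i, j)) (\<lambda>i. Im (z i))"
  have "q \<ge> 0" using pf by (simp add: q_def psd_fun_def)
  obtain i where i: "i < n" "z i \<noteq> 0"
    using v(1,2) by (metis carrier_vecD eq_vecI index_zero_vec z_def)
  have "S > 0" unfolding S_def by (rule sum_pos2[of _ i]) (use i in auto)
  have eig: "(\<Sum>j<n. complex_of_real (A $$ (i, j)) * z j) = e * z i" if "i < n" for i
  proof -
    have "vec_index (map_mat complex_of_real A *\<^sub>v v) i = vec_index (e \<cdot>\<^sub>v v) i" using v(3) by simp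
    then show ?thesis
      using that A v(1) by (simp add: scalar_prod_def z_def lessThan_atLeast0)
  qed
  have "(\<Sum>i<n. \<Sum>j<n. cnj (z i) * complex_of_real (A $$ (i, j)) * z j) = (\<Sum>i<n. cnj (z i) * (e * z i))"
    by (intro sum.cong refl) (simp add: eig[symmetric] sum_distrib_left mult.assoc)
  also have "\<dots> = e * complex_of_real S"
    unfolding S_def of_real_sum sum_distrib_left
    by (intro sum.cong refl) (simp only: complex_norm_square mult_ac)
  finally have *: "(\<Sum>i<n. \<Sum>j<n. cnj (z i) * complex_of_real (A $$ (i, j)) * z j) = e * complex_of_real S" .
  have "(\<Sum>i<n. \<Sum>j<n. cnj (z i) * complex_of_real (A $$ (i, j)) * z j) = complex_of_real q"
  proof (rule complex_eqI)
    show "Re (\<Sum>i<n. \<Sum>j<n. cnj (z i) * complex_of_real (A $$ (i, j)) * z j) = Re (complex_of_real q)"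
      unfolding q_def quad_form_def Re_sum sum.distrib[symmetric] Re_complex_of_real
      by (intro sum.cong refl) (simp add: algebra_simps)
    have "Im (\<Sum>i<n. \<Sum>j<n. cnj (z i) * complex_of_real (A $$ (i, j)) * z j) =
        (\<Sum>i<n. \<Sum>j<n. A $$ (i, j) * (Re (z i) * Im (z j))) - (\<Sum>i<n. \<Sum>j<n. A $$ (i, j) * (Im (z i) * Re (z j)))"
      unfolding Im_sum sum_subtractf[symmetric]
      by (intro sum.cong refl) (simp add: algebra_simps)
    also have "(\<Sum>i<n. \<Sum>j<n. A $$ (i, j) * (Im (z i) * Re (z j))) = (\<Sum>i<n. \<Sum>j<n. A $$ (i, j) * (Re (z i) * Im (z j)))"
      by (subst sum.swap) (intro sum.cong refl, simp add: sym mult_ac)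
    finally show "Im (\<Sum>i<n. \<Sum>j<n. cnj (z i) * complex_of_real (A $$ (i, j)) * z j) = Im (complex_of_real q)"
      by simp
  qed
  with * have "e = complex_of_real (q / S)" using \<open>S > 0\<close> by (simp add: field_simps)
  moreover have "q / S \<ge> 0" using \<open>q \<ge> 0\<close> \<open>S > 0\<close> by simp
  ultimately show ?thesis using that by blast
qed

text \<open>Over the complex numbers the characteristic polynomial splits, and a similar triangular
  matrix carries the eigenvalues on its diagonal. Traces of powers are all that the trace of an
  exponential depends on.\<close>

lemma psd_trace_pow:
  assumes psd: "psd_mat n A"
  obtains l :: "nat \<Rightarrow> real" where "\<And>j. j < n \<Longrightarrow> l j \<ge> 0" "\<And>k. mat_trace (A ^\<^sub>m k) = (\<Sum>j<n. l j ^ k)"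
proof -
  have A: "A \<in> carrier_mat n n" using psd by (simp add: psd_mat_def)
  define C where "C = map_mat complex_of_real A"
  have C: "C \<in> carrier_mat n n" using A by (simp add: C_def)
  obtain es where "char_poly C = (\<Prod>a\<leftarrow>es. [:- a, 1:])" using char_poly_factorized[OF C] by blast
  from schur_upper_triangular[OF C this] obtain B where
    B: "B \<in> carrier_mat n n" "upper_triangular B" "similar_mat C B" by blast
  have "eigenvalue C (B $$ (j, j))" if "j < n" for j
  proof -
    have "char_poly C = (\<Prod>a\<leftarrow>diag_mat B. [:- a, 1:])"
      using char_poly_similar[OF B(3)] char_poly_upper_triangular[OF B(1,2)] by simp
    moreover have "B $$ (j, j) \<in> set (diag_mat B)" using that B(1) by (auto simp: diag_mat_def)
    ultimately have "poly (char_poly C) (B $$ (j, j)) = 0"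
      by (auto simp: poly_prod_list prod_list_zero_iff)
    then show ?thesis using eigenvalue_root_char_poly[OF C] by blast
  qed
  then have "\<exists>l\<ge>0. B $$ (j, j) = complex_of_real l" if "j < n" for j
    using eigenvalue_complex_psd[OF psd] that unfolding C_def by metis
  then obtain l where l: "\<And>j. j < n \<Longrightarrow> l j \<ge> 0 \<and> B $$ (j, j) = complex_of_real (l j)" by metis
  have "mat_trace (A ^\<^sub>m k) = (\<Sum>j<n. l j ^ k)" for k
  proof -
    have "complex_of_real (mat_trace (A ^\<^sub>m k)) = (\<Sum>i<n. (C ^\<^sub>m k) $$ (i, i))"
      using A pow_carrier_mat[OF A, of k] unfolding C_def of_real_hom.mat_hom_pow[OF A, symmetric]
      by (simp add: mat_trace_def)
    also have "\<dots> = (\<Sum>i<n. (B ^\<^sub>m k) $$ (i, i))" by (rule trace_pow_similar[OF C B(3)])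
    also have "\<dots> = complex_of_real (\<Sum>j<n. l j ^ k)"
      using upper_triangular_pow[OF B(1,2), of k] l by simp
    finally show ?thesis unfolding of_real_eq_iff .
  qed
  with l show ?thesis using that by blast
qed

text \<open>The numbers \<open>l\<close> come from the powers of \<open>A\<close> and are fixed
  before \<open>y\<close>, so one choice serves all multiples of \<open>A\<close>. This uniformity
  exhibits the trace, as a function of \<open>y\<close>, as a finite sum of decaying
  exponentials.\<close>

lemma mat_trace_mat_exp_psd:
  assumes psd: "psd_mat n A"
  obtains l :: "nat \<Rightarrow> real" where "\<And>j. j < n \<Longrightarrow> l j \<ge> 0"
    "\<And>y. mat_trace (mat_exp (- (y \<cdot>\<^sub>m A))) = (\<Sum>j<n. exp (- l j * y))"
proof -
  have A: "A \<in> carrier_mat n n" using psd by (simp add: psd_mat_def)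
  obtain l where l: "\<And>j. j < n \<Longrightarrow> l j \<ge> 0" "\<And>k. mat_trace (A ^\<^sub>m k) = (\<Sum>j<n. l j ^ k)"
    using psd_trace_pow[OF psd] by blast
  have "mat_trace (mat_exp (- (y \<cdot>\<^sub>m A))) = (\<Sum>j<n. exp (- l j * y))" for y
  proof -
    define B where "B = (- y) \<cdot>\<^sub>m A"
    have B: "B \<in> carrier_mat n n" using A by (simp add: B_def)
    have "- (y \<cdot>\<^sub>m A) = B" using A by (intro eq_matI) (auto simp: B_def)
    then have "mat_trace (mat_exp (- (y \<cdot>\<^sub>m A))) = (\<Sum>i<n. \<Sum>k. (B ^\<^sub>m k) $$ (i, i) / fact k)"
      using mat_exp_carrier[OF B] by (simp add: mat_trace_def mat_exp_entry[OF B])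
    also have "\<dots> = (\<Sum>k. \<Sum>i<n. (B ^\<^sub>m k) $$ (i, i) / fact k)"
      by (rule suminf_sum[symmetric]) (use summable_norm_cancel[OF summable_mat_exp[OF B]] in auto)
    also have "\<dots> = (\<Sum>k. \<Sum>j<n. (- l j * y) ^ k / fact k)"
    proof (rule suminf_cong)
      fix k
      have "(\<Sum>i<n. (B ^\<^sub>m k) $$ (i, i) / fact k) = (- y) ^ k * mat_trace (A ^\<^sub>m k) / fact k"
        using A pow_carrier_mat[OF A, of k]
        by (simp add: B_def smult_pow_mat_entry[OF A] mat_trace_def sum_divide_distrib sum_distrib_left)
      also have "\<dots> = (\<Sum>j<n. (- l j * y) ^ k / fact k)"
      proof -
        have "- l j * y = (- y) * l j" for j by simp
        then show ?thesis
          by (simp only: l(2) power_mult_distrib sum_divide_distrib sum_distrib_left)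
      qed
      finally show "(\<Sum>i<n. (B ^\<^sub>m k) $$ (i, i) / fact k) = (\<Sum>j<n. (- l j * y) ^ k / fact k)" .
    qed
    also have "\<dots> = (\<Sum>j<n. \<Sum>k. (- l j * y) ^ k / fact k)"
      by (rule suminf_sum) (use summable_exp in \<open>auto simp: divide_inverse mult.commute\<close>)
    also have "\<dots> = (\<Sum>j<n. exp (- l j * y))"
      by (simp add: exp_def divide_inverse mult.commute)
    finally show ?thesis .
  qed
  with l(1) show ?thesis using that by blast
qed

section \<open>Expectations of matrix exponentials\<close>

lemma mat_trace_diff:
  assumes "A \<in> carrier_mat n n" "B \<in> carrier_mat n n"
  shows "mat_trace (A - B) = mat_trace A - mat_trace B"
  using assms by (simp add: mat_trace_def sum_subtractf)

lemma mat_exp_scaled_entry_measurable: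
  assumes A: "A \<in> carrier_mat n n" and ij: "i < n" "j < n"
  shows "(\<lambda>y. mat_exp (- (y \<cdot>\<^sub>m A)) $$ (i, j)) \<in> borel_measurable borel"
proof -
  have "mat_exp (- (y \<cdot>\<^sub>m A)) $$ (i, j) = (\<Sum>k. (- y) ^ k * (A ^\<^sub>m k) $$ (i, j) / fact k)" for y
  proof -
    have eq: "- (y \<cdot>\<^sub>m A) = (- y) \<cdot>\<^sub>m A" by (rule eq_matI) auto
    have "(- y) \<cdot>\<^sub>m A \<in> carrier_mat n n" using A by simp
    then show ?thesis
      unfolding eq by (simp only: mat_exp_entry[OF _ ij] smult_pow_mat_entry[OF A ij])
  qed
  then show ?thesis by simp
qed

text \<open>Diagonal entries are nonnegative, so each is bounded by the trace, a sum of
  \<open>n\<close> exponentials that are at most 1 when \<open>y \<ge> 0\<close>.\<close>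

lemma mat_exp_psd_diag_bounds:
  assumes psd: "psd_mat n A" and i: "i < n"
  shows "mat_exp (- (y \<cdot>\<^sub>m A)) $$ (i, i) \<ge> 0"
    and "y \<ge> 0 \<Longrightarrow> mat_exp (- (y \<cdot>\<^sub>m A)) $$ (i, i) \<le> real n"
proof -
  have A: "A \<in> carrier_mat n n" "transpose_mat A = A" using psd by (auto simp: psd_mat_def)
  have eq: "- (y \<cdot>\<^sub>m A) = (- y) \<cdot>\<^sub>m A" by (rule eq_matI) auto
  have carrier: "- (y \<cdot>\<^sub>m A) \<in> carrier_mat n n" using A by simp
  have nonneg: "mat_exp (- (y \<cdot>\<^sub>m A)) $$ (j, j) \<ge> 0" if "j < n" for j
    by (rule mat_exp_diag_nonneg[OF carrier _ that]) (simp add: eq transpose_smult A)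
  then show "mat_exp (- (y \<cdot>\<^sub>m A)) $$ (i, i) \<ge> 0" using i by blast
  assume y: "y \<ge> 0"
  obtain l :: "nat \<Rightarrow> real" where l: "\<And>j. j < n \<Longrightarrow> l j \<ge> 0"
    "\<And>y. mat_trace (mat_exp (- (y \<cdot>\<^sub>m A))) = (\<Sum>j<n. exp (- l j * y))"
    using mat_trace_mat_exp_psd[OF psd] by blast
  have "mat_exp (- (y \<cdot>\<^sub>m A)) $$ (i, i) \<le> (\<Sum>j<n. mat_exp (- (y \<cdot>\<^sub>m A)) $$ (j, j))"
    by (rule member_le_sum) (use i nonneg in auto)
  also have "\<dots> = (\<Sum>j<n. exp (- l j * y))"
    using l(2)[of y] carrier_matD[OF mat_exp_carrier[OF carrier]] by (simp add: mat_trace_def)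
  also have "\<dots> \<le> (\<Sum>j<n. 1)"
    by (rule sum_mono) (use l(1) y in auto)
  finally show "mat_exp (- (y \<cdot>\<^sub>m A)) $$ (i, i) \<le> real n" by simp
qed

lemma abs_exp_mixture_mat_trace_mat_exp:
  assumes "psd_mat n A"
  shows "abs_exp_mixture (\<lambda>x. mat_trace (mat_exp (- (\<bar>x\<bar> \<cdot>\<^sub>m A))))"
proof -
  obtain l :: "nat \<Rightarrow> real" where l: "\<And>j. j < n \<Longrightarrow> l j \<ge> 0"
    "\<And>y. mat_trace (mat_exp (- (y \<cdot>\<^sub>m A))) = (\<Sum>j<n. exp (- l j * y))"
    using mat_trace_mat_exp_psd[OF assms] by blast
  show ?thesis
    unfolding l(2) by (rule abs_exp_mixture_sum) (use l(1) in \<open>blast intro: abs_exp_mixture.exp\<close>)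
qed

text \<open>The trace of an expectation is a sum of integrals, which merges into one integral once
  every diagonal entry is known to be integrable. The digit representation of a diagonal entry
  reduces this to bounded factors.\<close>

lemma (in prob_space) mat_trace_mat_expectation_mat_exp_kron_sum_list:
  fixes X :: "nat \<Rightarrow> 'a \<Rightarrow> real"
  assumes xs: "xs \<noteq> []" "distinct xs"
    and X: "\<And>i. i \<in> set xs \<Longrightarrow> X i \<in> borel_measurable M"
    and nonneg: "AE \<omega> in M. \<forall>i\<in>set xs. X i \<omega> \<ge> 0"
    and psd: "\<And>i. i \<in> set xs \<Longrightarrow> psd_mat n (A i)"
  shows "mat_trace (mat_expectation M (n ^ length xs)
      (\<lambda>\<omega>. mat_exp (- kron_sum_list (map (\<lambda>i. X i \<omega> \<cdot>\<^sub>m A i) xs)))) =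
    (\<integral>\<omega>. (\<Prod>i\<in>set xs. mat_trace (mat_exp (- (\<bar>X i \<omega>\<bar> \<cdot>\<^sub>m A i)))) \<partial>M)"
proof -
  define L where "L \<omega> = map (\<lambda>i. - (X i \<omega> \<cdot>\<^sub>m A i)) xs" for \<omega>
  define Y where "Y \<omega> = mat_exp (- kron_sum_list (map (\<lambda>i. X i \<omega> \<cdot>\<^sub>m A i) xs))" for \<omega>
  define N where "N = n ^ length xs"
  have A: "A i \<in> carrier_mat n n" if "i \<in> set xs" for i using psd[OF that] by (simp add: psd_mat_def)
  have L: "B \<in> carrier_mat n n" if "B \<in> set (L \<omega>)" for B \<omega>
    using that A by (auto simp: L_def)
  have YL: "Y \<omega> = mat_exp (kron_sum_list (L \<omega>))" for \<omega>
  proof -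
    have "- kron_sum_list (map (\<lambda>i. X i \<omega> \<cdot>\<^sub>m A i) xs) = kron_sum_list (map uminus (map (\<lambda>i. X i \<omega> \<cdot>\<^sub>m A i) xs))"
      by (rule uminus_kron_sum_list[of _ n]) (use A in auto)
    then show ?thesis by (simp add: Y_def L_def comp_def)
  qed
  have Y: "Y \<omega> \<in> carrier_mat N N" for \<omega>
  proof -
    have "kron_sum_list (L \<omega>) \<in> carrier_mat (n ^ length (L \<omega>)) (n ^ length (L \<omega>))"
      by (rule kron_sum_list_carrier) (rule L)
    moreover have "n ^ length (L \<omega>) = N" by (simp add: L_def N_def)
    ultimately show ?thesis unfolding YL by (simp only: mat_exp_carrier)
  qed
  have int: "integrable M (\<lambda>\<omega>. Y \<omega> $$ (a, a))" if a: "a < N" for a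
  proof -
    obtain m where m: "length xs = Suc m" using xs by (cases xs) auto
    obtain cs where cs: "length cs = Suc m" "\<forall>c\<in>set cs. c < n"
      "\<And>Bs. length Bs = Suc m \<Longrightarrow> \<forall>B\<in>set Bs. B \<in> carrier_mat n n \<Longrightarrow>
        mat_exp (kron_sum_list Bs) $$ (a, a) = (\<Prod>i<Suc m. mat_exp (Bs ! i) $$ (cs ! i, cs ! i))"
      using mat_exp_kron_sum_list_diag[of a n m] a unfolding N_def m by blast
    have c: "cs ! i < n" if "i < Suc m" for i using cs(1,2) that by (metis nth_mem)
    have mem: "xs ! i \<in> set xs" if "i < Suc m" for i using that m by (metis nth_mem)
    let ?g = "\<lambda>i y. mat_exp (- (y \<cdot>\<^sub>m A (xs ! i))) $$ (cs ! i, cs ! i)"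
    have eq: "Y \<omega> $$ (a, a) = (\<Prod>i<Suc m. ?g i (X (xs ! i) \<omega>))" for \<omega>
    proof -
      have "Y \<omega> $$ (a, a) = (\<Prod>i<Suc m. mat_exp (L \<omega> ! i) $$ (cs ! i, cs ! i))"
        unfolding YL by (rule cs(3)) (use L m in \<open>auto simp: L_def\<close>)
      also have "\<dots> = (\<Prod>i<Suc m. ?g i (X (xs ! i) \<omega>))"
        by (intro prod.cong refl) (use m in \<open>simp add: L_def\<close>)
      finally show ?thesis .
    qed
    show ?thesis
    proof (rule integrable_const_bound[where B = "real n ^ Suc m"])
      show "(\<lambda>\<omega>. Y \<omega> $$ (a, a)) \<in> borel_measurable M"
        unfolding eq
      proof (rule borel_measurable_prod)
        fix i assume "i \<in> {..<Suc m}"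
        then have i: "i < Suc m" by simp
        show "(\<lambda>\<omega>. ?g i (X (xs ! i) \<omega>)) \<in> borel_measurable M"
          by (rule measurable_compose[OF X[OF mem[OF i]]
            mat_exp_scaled_entry_measurable[OF A[OF mem[OF i]] c[OF i] c[OF i]]])
      qed
      \<comment> \<open>The bound is claimed only almost surely, since the upper estimate on each
        factor is for nonnegative arguments.\<close>
      show "AE \<omega> in M. norm (Y \<omega> $$ (a, a)) \<le> real n ^ Suc m"
        using nonneg
      proof eventually_elim
        case (elim \<omega>)
        have g: "0 \<le> ?g i (X (xs ! i) \<omega>) \<and> ?g i (X (xs ! i) \<omega>) \<le> real n" if "i \<in> {..<Suc m}" for i
        proof -
          have i: "i < Suc m" using that by simp
          show ?thesis
            using mat_exp_psd_diag_bounds[OF psd[OF mem[OF i]] c[OF i]] elim mem[OF i] by blast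
        qed
        have "(\<Prod>i<Suc m. ?g i (X (xs ! i) \<omega>)) \<le> (\<Prod>i<Suc m. real n)"
          by (rule prod_mono) (rule g)
        moreover have "0 \<le> (\<Prod>i<Suc m. ?g i (X (xs ! i) \<omega>))"
          by (rule prod_nonneg) (use g in blast)
        ultimately show ?case unfolding eq by (simp only: real_norm_def abs_of_nonneg prod_constant card_lessThan)
      qed
    qed
  qed
  have "mat_trace (mat_expectation M N Y) = (\<Sum>a<N. \<integral>\<omega>. Y \<omega> $$ (a, a) \<partial>M)"
    by (simp add: mat_trace_def mat_expectation_def)
  also have "\<dots> = (\<integral>\<omega>. (\<Sum>a<N. Y \<omega> $$ (a, a)) \<partial>M)"
    by (rule Bochner_Integration.integral_sum[symmetric]) (use int in simp)
  also have "\<dots> = (\<integral>\<omega>. mat_trace (Y \<omega>) \<partial>M)"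
    using carrier_matD[OF Y] by (simp add: mat_trace_def)
  also have "\<dots> = (\<integral>\<omega>. (\<Prod>i\<in>set xs. mat_trace (mat_exp (- (X i \<omega> \<cdot>\<^sub>m A i)))) \<partial>M)"
  proof -
    have "mat_trace (Y \<omega>) = (\<Prod>i\<in>set xs. mat_trace (mat_exp (- (X i \<omega> \<cdot>\<^sub>m A i))))" for \<omega>
    proof -
      have "L \<omega> \<noteq> []" using xs by (simp add: L_def)
      from mat_exp_kron_sum_list_trace[OF this L] show ?thesis
        by (simp add: YL L_def comp_def prod.distinct_set_conv_list[OF xs(2)])
    qed
    then show ?thesis by simp
  qed
  also have "\<dots> = (\<integral>\<omega>. (\<Prod>i\<in>set xs. mat_trace (mat_exp (- (\<bar>X i \<omega>\<bar> \<cdot>\<^sub>m A i)))) \<partial>M)"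
  proof (rule integral_cong_AE)
    have 1: "(\<lambda>y. mat_trace (mat_exp (- (y \<cdot>\<^sub>m A i)))) \<in> borel_measurable borel" if i: "i \<in> set xs" for i
    proof -
      obtain l :: "nat \<Rightarrow> real" where
        l: "\<And>y. mat_trace (mat_exp (- (y \<cdot>\<^sub>m A i))) = (\<Sum>j<n. exp (- l j * y))"
        using mat_trace_mat_exp_psd[OF psd[OF i]] by blast
      show ?thesis unfolding l by simp
    qed
    show "(\<lambda>\<omega>. \<Prod>i\<in>set xs. mat_trace (mat_exp (- (X i \<omega> \<cdot>\<^sub>m A i)))) \<in> borel_measurable M"
      by (rule borel_measurable_prod) (rule measurable_compose[OF X 1])
    show "(\<lambda>\<omega>. \<Prod>i\<in>set xs. mat_trace (mat_exp (- (\<bar>X i \<omega>\<bar> \<cdot>\<^sub>m A i)))) \<in> borel_measurable M"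
      by (rule borel_measurable_prod) (rule measurable_compose[OF borel_measurable_abs[OF X] 1])
    show "AE \<omega> in M. (\<Prod>i\<in>set xs. mat_trace (mat_exp (- (X i \<omega> \<cdot>\<^sub>m A i)))) =
        (\<Prod>i\<in>set xs. mat_trace (mat_exp (- (\<bar>X i \<omega>\<bar> \<cdot>\<^sub>m A i))))"
      using nonneg by eventually_elim (intro prod.cong refl, simp)
  qed
  finally show ?thesis unfolding Y_def N_def .
qed

lemma (in prob_space) trace_wishart_mat_exp:
  assumes tw: "trace_wishart M d p \<alpha> \<Sigma> X" "psd_mat (\<Sum>i = 1..d. p i) \<Sigma>" "\<alpha> \<ge> 0"
    and d: "d1 \<in> {1..d - 1}"
    and psd: "\<And>i. i \<in> {1..d} \<Longrightarrow> psd_mat n (A i)"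
  shows "mat_trace
    (mat_expectation M (n ^ d) (\<lambda>\<omega>. mat_exp (- kron_sum_list (map (\<lambda>i. X i \<omega> \<cdot>\<^sub>m A i) [1..<d + 1]))) -
     kron_prod
       (mat_expectation M (n ^ d1) (\<lambda>\<omega>. mat_exp (- kron_sum_list (map (\<lambda>i. X i \<omega> \<cdot>\<^sub>m A i) [1..<d1 + 1]))))
       (mat_expectation M (n ^ (d - d1)) (\<lambda>\<omega>. mat_exp (- kron_sum_list (map (\<lambda>i. X i \<omega> \<cdot>\<^sub>m A i) [d1 + 1..<d + 1]))))) \<ge> 0"
proof -
  define E where "E xs = mat_expectation M (n ^ length xs)
    (\<lambda>\<omega>. mat_exp (- kron_sum_list (map (\<lambda>i. X i \<omega> \<cdot>\<^sub>m A i) xs)))" for xs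
  define f where "f i x = mat_trace (mat_exp (- (\<bar>x\<bar> \<cdot>\<^sub>m A i)))" for i x
  have carrier: "E xs \<in> carrier_mat (n ^ length xs) (n ^ length xs)" for xs
    by (simp add: E_def mat_expectation_def)
  have trace: "mat_trace (E xs) = (\<integral>\<omega>. (\<Prod>i\<in>set xs. f i (X i \<omega>)) \<partial>M)"
    if xs: "xs \<noteq> []" "distinct xs" "set xs \<subseteq> {1..d}" for xs
    unfolding E_def f_def
  proof (rule mat_trace_mat_expectation_mat_exp_kron_sum_list[OF xs(1,2)])
    show "X i \<in> borel_measurable M" if "i \<in> set xs" for i
      using tw(1) xs(3) that by (auto simp: trace_wishart_def)
    show "AE \<omega> in M. \<forall>i\<in>set xs. X i \<omega> \<ge> 0"
      using trace_wishart_AE_nonneg[OF tw] by eventually_elim (use xs(3) in blast)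
    show "psd_mat n (A i)" if "i \<in> set xs" for i using psd xs(3) that by blast
  qed
  let ?I = "[1..<d1 + 1]" and ?J = "[d1 + 1..<d + 1]" and ?K = "[1..<d + 1]"
  have sets: "set ?I \<union> set ?J = {1..d}" "set ?I \<inter> set ?J = {}" "set ?K = {1..d}" using d by auto
  have "pos_assoc X (set ?I) (set ?J) f"
    by (rule trace_wishart_pos_assoc[OF tw sets(1,2)])
      (unfold f_def, rule abs_exp_mixture_mat_trace_mat_exp, rule psd)
  moreover have "mat_trace (E ?I) = (\<integral>\<omega>. (\<Prod>i\<in>set ?I. f i (X i \<omega>)) \<partial>M)"
    "mat_trace (E ?J) = (\<integral>\<omega>. (\<Prod>i\<in>set ?J. f i (X i \<omega>)) \<partial>M)"
    "mat_trace (E ?K) = (\<integral>\<omega>. (\<Prod>i\<in>set ?K. f i (X i \<omega>)) \<partial>M)"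
    by (rule trace; use d in auto)+
  ultimately have "mat_trace (E ?I) * mat_trace (E ?J) \<le> mat_trace (E ?K)"
    unfolding pos_assoc_def sets by (simp only:)
  moreover have "mat_trace (E ?K - kron_prod (E ?I) (E ?J)) = mat_trace (E ?K) - mat_trace (E ?I) * mat_trace (E ?J)"
  proof -
    \<comment> \<open>The sizes of the two factors multiply to that of the full Kronecker sum, so
      the trace of the difference splits.\<close>
    have "n ^ length ?I * n ^ length ?J = n ^ length ?K"
    proof -
      have "d1 + (d - d1) = d" using d by auto
      then show ?thesis by (simp flip: power_add del: upt_Suc)
    qed
    then have "kron_prod (E ?I) (E ?J) \<in> carrier_mat (n ^ length ?K) (n ^ length ?K)"
      using kron_prod_carrier[OF carrier[of ?I] carrier[of ?J]] by (simp only:)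
    then show ?thesis
      by (simp only: mat_trace_diff[OF carrier] mat_trace_kron_prod[OF carrier carrier])
  qed
  moreover have "length ?I = d1" "length ?J = d - d1" "length ?K = d" by (simp_all del: upt_Suc)
  ultimately show ?thesis unfolding E_def by (simp only: diff_ge_0_iff_ge)
qed

theorem corollary1:
  fixes M :: "'a measure"
    and d d1 :: nat
    and p :: "nat \<Rightarrow> nat"
    and \<alpha> :: real
    and \<Sigma> :: "real mat"
    and X :: "nat \<Rightarrow> 'a \<Rightarrow> real"
  assumes "prob_space M"
    and "d \<ge> 2"
    and "\<forall>i \<in> {1..d}. p i \<ge> 1"
    and "2 * \<alpha> \<in> real ` {1..} \<union> {real (\<Sum>i = 1..d. p i) - 1 <..}"
    and "psd_mat (\<Sum>i = 1..d. p i) \<Sigma>"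
    and "trace_wishart M d p \<alpha> \<Sigma> X"
    and "d1 \<in> {1..d - 1}"
  shows
    "(\<forall>q :: nat \<Rightarrow> real. (\<forall>i \<in> {1..d}. q i \<in> {- \<alpha> <.. 0}) \<longrightarrow>
        (\<integral>\<^sup>+ \<omega>. (\<Prod>i = 1..d. epow (X i \<omega>) (q i)) \<partial>M) \<ge>
        (\<integral>\<^sup>+ \<omega>. (\<Prod>i = 1..d1. epow (X i \<omega>) (q i)) \<partial>M) *
        (\<integral>\<^sup>+ \<omega>. (\<Prod>i = d1 + 1..d. epow (X i \<omega>) (q i)) \<partial>M)) \<and>
     (\<forall>r :: nat \<Rightarrow> real. (\<forall>i \<in> {1..d}. r i \<in> {0..1}) \<longrightarrow>
        (\<integral>\<^sup>+ \<omega>. ennreal (\<Prod>i = 1..d. exp (- rpow (X i \<omega>) (r i))) \<partial>M) \<ge>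
        (\<integral>\<^sup>+ \<omega>. ennreal (\<Prod>i = 1..d1. exp (- rpow (X i \<omega>) (r i))) \<partial>M) *
        (\<integral>\<^sup>+ \<omega>. ennreal (\<Prod>i = d1 + 1..d. exp (- rpow (X i \<omega>) (r i))) \<partial>M)) \<and>
     (\<forall>(n :: nat) (A :: nat \<Rightarrow> real mat). n \<ge> 1 \<longrightarrow> (\<forall>i \<in> {1..d}. psd_mat n (A i)) \<longrightarrow>
        mat_trace
          (mat_expectation M (n ^ d)
             (\<lambda>\<omega>. mat_exp (- kron_sum_list (map (\<lambda>i. X i \<omega> \<cdot>\<^sub>m A i) [1..<d + 1]))) -
           kron_prod
             (mat_expectation M (n ^ d1)
                (\<lambda>\<omega>. mat_exp (- kron_sum_list (map (\<lambda>i. X i \<omega> \<cdot>\<^sub>m A i) [1..<d1 + 1]))))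
             (mat_expectation M (n ^ (d - d1))
                (\<lambda>\<omega>. mat_exp (- kron_sum_list (map (\<lambda>i. X i \<omega> \<cdot>\<^sub>m A i) [d1 + 1..<d + 1]))))) \<ge> 0)"
proof -
  interpret prob_space M by fact
  \<comment> \<open>The condition on \<open>2 * \<alpha>\<close> offers two alternatives; the second
    fixes the sign because \<open>p 1 \<ge> 1\<close> makes the total size at least 1.\<close>
  have \<alpha>: "\<alpha> \<ge> 0"
  proof -
    have "p 1 \<le> (\<Sum>i = 1..d. p i)" by (rule member_le_sum) (use assms(2) in auto)
    moreover have "p 1 \<ge> 1" using assms(2,3) by simp
    ultimately have "real 1 \<le> real (\<Sum>i = 1..d. p i)" unfolding of_nat_le_iff by linarith
    with assms(4) show ?thesis by auto
  qed
  note tw = assms(6,5) \<alpha>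
  have IJ: "{1..d1} \<union> {d1 + 1..d} = {1..d}" "{1..d1} \<inter> {d1 + 1..d} = {}" using assms(7) by auto
  show ?thesis
  proof (intro conjI allI impI)
    fix q :: "nat \<Rightarrow> real" assume "\<forall>i\<in>{1..d}. q i \<in> {- \<alpha> <.. 0}"
    then show "(\<integral>\<^sup>+ \<omega>. (\<Prod>i = 1..d. epow (X i \<omega>) (q i)) \<partial>M) \<ge>
        (\<integral>\<^sup>+ \<omega>. (\<Prod>i = 1..d1. epow (X i \<omega>) (q i)) \<partial>M) *
        (\<integral>\<^sup>+ \<omega>. (\<Prod>i = d1 + 1..d. epow (X i \<omega>) (q i)) \<partial>M)"
      by (intro trace_wishart_epow[OF tw IJ]) simp
  next
    fix r :: "nat \<Rightarrow> real" assume "\<forall>i\<in>{1..d}. r i \<in> {0..1}"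
    then show "(\<integral>\<^sup>+ \<omega>. ennreal (\<Prod>i = 1..d. exp (- rpow (X i \<omega>) (r i))) \<partial>M) \<ge>
        (\<integral>\<^sup>+ \<omega>. ennreal (\<Prod>i = 1..d1. exp (- rpow (X i \<omega>) (r i))) \<partial>M) *
        (\<integral>\<^sup>+ \<omega>. ennreal (\<Prod>i = d1 + 1..d. exp (- rpow (X i \<omega>) (r i))) \<partial>M)"
      by (intro trace_wishart_exp_rpow[OF tw IJ]) simp
  next
    fix n :: nat and A :: "nat \<Rightarrow> real mat" assume "\<forall>i\<in>{1..d}. psd_mat n (A i)"
    then show "mat_trace
          (mat_expectation M (n ^ d)
             (\<lambda>\<omega>. mat_exp (- kron_sum_list (map (\<lambda>i. X i \<omega> \<cdot>\<^sub>m A i) [1..<d + 1]))) -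
           kron_prod
             (mat_expectation M (n ^ d1)
                (\<lambda>\<omega>. mat_exp (- kron_sum_list (map (\<lambda>i. X i \<omega> \<cdot>\<^sub>m A i) [1..<d1 + 1]))))
             (mat_expectation M (n ^ (d - d1))
                (\<lambda>\<omega>. mat_exp (- kron_sum_list (map (\<lambda>i. X i \<omega> \<cdot>\<^sub>m A i) [d1 + 1..<d + 1]))))) \<ge> 0"
      by (intro trace_wishart_mat_exp[OF tw assms(7)]) simp
  qed
qed

end
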